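(* Let $X$ be a smooth manifold, $\Gamma=\pi_1(X)$ and $\chi\in H^1(X,\mathbb{R})$ a nonzero class. Suppose that there exists a taming pair $(\Phi,\alpha)$ for $\chi$ on $X$. Let $\pi\colon\widetilde X\to X$ be the universal cover of $X$ and $h\colon\widetilde X\to\mathbb{R}$ be such that $dh=\pi^*\alpha$. Suppose also that $\widetilde X_h:=h^{-1}([0,+\infty))$ is connected. Then under the canonical identification $H^1(X,\mathbb{R})\simeq H^1(\Gamma,\mathbb{R})$ one has $[\chi]\in\Sigma(\Gamma)$.
   Context: BNS set. Let $\Gamma$ be a finitely generated group and $S=S^{-1}$ a finite symmetric generating set. The Cayley graph $C(\Gamma,S)$ has vertex set $\Gamma$, with $\gamma,\gamma'$ joined by an edge iff $\gamma'=s\gamma$ for some $s\in S$. For a nonzero additive character $\chi\colon\Gamma\to(\mathbb{R},+)$, i.e. a nonzero element of $H^1(\Gamma,\mathbb{R})$, $C_\chi(\Gamma,S)$ is the subgraph spanned by $\{\gamma:\chi(\gamma)\ge 0\}$. Put $\mathbb{S}H^1(\Gamma,\mathbb{R})=(H^1(\Gamma,\mathbb{R})\setminus\{0\})/\mathbb{R}^\times_{>0}$ and let $[\chi]$ be the ray of $\chi$. Then $\Sigma(\Gamma)=\{[\chi] : C_\chi(\Gamma,S)\text{ is connected for some } S\}\subseteq\mathbb{S}H^1(\Gamma,\mathbb{R})$ (independent of $S$). Fundamental domains. For a finitely generated group $\Gamma$ acting freely and properly discontinuously on a space $\widetilde Y$, an open subset $\Phi\subset\widetilde Y$ is a $\Gamma$-fundamental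 domain if $(\overline{\Phi})^\circ=\Phi$, $\bigcup_{\gamma}\gamma\overline\Phi=\widetilde Y$, $\gamma\Phi\cap\Phi=\varnothing$ for nontrivial $\gamma$, and $\{\gamma\overline\Phi\}_{\gamma}$ is locally finite. It is geometrically finite if $S_\Phi=\{\gamma\in\Gamma\setminus\{e\}:\gamma\overline\Phi\cap\overline\Phi\neq\varnothing\}$ is finite. The group $\pi_1(X)$ acts on $\widetilde X$ by deck transformations. Taming pairs. Let $\chi\in H^1(X,\mathbb{R})$ be a nonzero class. A taming pair for $\chi$ on $X$ is a pair $(\Phi,\alpha)$, where $\Phi\subset\widetilde X$ is a $\pi_1(X)$-fundamental domain and $\alpha$ a closed $1$-form on $X$, such that (i) $\Phi$ is geometrically finite; (ii) the de Rham class of $\alpha$ is $\chi$; (iii) if $h\colon\widetilde X\to\mathbb{R}$ is a smooth function with $\pi^*\alpha=dh$, then $h|_\Phi$ is bounded from above. *)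

theory Defs
  imports "HOL-Analysis.Analysis" "HOL-Algebra.Generated_Groups"
begin

section \<open>Smooth manifolds\<close>

text \<open>\<open>higher_differentiable_on S f k\<close>: \<open>f\<close> is of class \<open>C\<^sup>k\<close> on \<open>S\<close>; only used for open \<open>S\<close>.\<close>

primrec higher_differentiable_on ::
  "'e::real_normed_vector set \<Rightarrow> ('e \<Rightarrow> 'f::real_normed_vector) \<Rightarrow> nat \<Rightarrow> bool" where
  "higher_differentiable_on S f 0 \<longleftrightarrow> continuous_on S f"
| "higher_differentiable_on S f (Suc k) \<longleftrightarrow>
     (\<forall>x\<in>S. f differentiable (at x)) \<and>
     (\<forall>v. higher_differentiable_on S (\<lambda>x. frechet_derivative f (at x) v) k)"

definition smooth_on :: "'e::real_normed_vector set \<Rightarrow> ('e \<Rightarrow> 'f::real_normed_vector) \<Rightarrow> bool" where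
  "smooth_on S f \<longleftrightarrow> (\<forall>k. higher_differentiable_on S f k)"

text \<open>A chart is a domain together with a coordinate map into the model space \<open>'e\<close>;
  \<open>chart_inv\<close> is the inverse parametrization, meaningful on the image of the domain.
  Manifolds are carrier sets with the subspace topology.\<close>

type_synonym ('a, 'e) chart = "'a set \<times> ('a \<Rightarrow> 'e)"

definition chart_inv :: "('a, 'e) chart \<Rightarrow> 'e \<Rightarrow> 'a" where
  "chart_inv c = inv_into (fst c) (snd c)"

definition smooth_manifold ::
  "'a::topological_space set \<Rightarrow> ('a, 'e::euclidean_space) chart set \<Rightarrow> bool" where
  "smooth_manifold X A \<longleftrightarrow>
     Hausdorff_space (top_of_set X) \<and> second_countable (top_of_set X) \<and>
     (\<Union>c\<in>A. fst c) = X \<and>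
     (\<forall>(U, \<phi>)\<in>A. openin (top_of_set X) U \<and> open (\<phi> ` U) \<and>
        (\<exists>\<psi>. homeomorphism U (\<phi> ` U) \<phi> \<psi>)) \<and>
     (\<forall>(U, \<phi>)\<in>A. \<forall>(V, \<psi>)\<in>A. smooth_on (\<phi> ` (U \<inter> V)) (\<psi> \<circ> chart_inv (U, \<phi>)))"

definition smooth_fun :: "('a, 'e::euclidean_space) chart set \<Rightarrow> ('a \<Rightarrow> real) \<Rightarrow> bool" where
  "smooth_fun A f \<longleftrightarrow> (\<forall>(U, \<phi>)\<in>A. smooth_on (\<phi> ` U) (f \<circ> chart_inv (U, \<phi>)))"

text \<open>Smoothness on an open subset \<open>D\<close> of the source manifold.\<close>

definition smooth_map_on ::
  "('a::topological_space, 'e::euclidean_space) chart set \<Rightarrow>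
   ('b::topological_space, 'e) chart set \<Rightarrow> 'a set \<Rightarrow> ('a \<Rightarrow> 'b) \<Rightarrow> bool" where
  "smooth_map_on A B D f \<longleftrightarrow> continuous_on D f \<and>
     (\<forall>(U, \<phi>)\<in>A. \<forall>(V, \<psi>)\<in>B.
        smooth_on (\<phi> ` (U \<inter> D \<inter> f -` V)) (\<psi> \<circ> f \<circ> chart_inv (U, \<phi>)))"

definition local_diffeomorphism ::
  "'a::topological_space set \<Rightarrow> ('a, 'e::euclidean_space) chart set \<Rightarrow>
   'b::topological_space set \<Rightarrow> ('b, 'e) chart set \<Rightarrow> ('a \<Rightarrow> 'b) \<Rightarrow> bool" where
  "local_diffeomorphism X A Y B f \<longleftrightarrow>
     (\<forall>x\<in>X. \<exists>D W g. x \<in> D \<and> openin (top_of_set X) D \<and> openin (top_of_set Y) W \<and>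
        homeomorphism D W f g \<and> smooth_map_on A B D f \<and> smooth_map_on B A W g)"

section \<open>One-forms and de Rham cohomology in degree one\<close>

text \<open>A one-form is given by its local expressions: \<open>\<alpha> c p v\<close> is the value at the point \<open>p\<close> on the
  tangent vector whose coordinates in the chart \<open>c\<close> are \<open>v\<close>. Only values with \<open>c\<close> in the atlas and
  \<open>p\<close> in the domain of \<open>c\<close> are meaningful, hence the relation \<open>form_eq\<close> instead of equality.\<close>

type_synonym ('a, 'e) form = "('a, 'e) chart \<Rightarrow> 'a \<Rightarrow> 'e \<Rightarrow> real"

definition form_eq :: "('a, 'e) chart set \<Rightarrow> ('a, 'e) form \<Rightarrow> ('a, 'e) form \<Rightarrow> bool" where
  "form_eq A \<alpha> \<beta> \<longleftrightarrow> (\<forall>c\<in>A. \<forall>p\<in>fst c. \<forall>v. \<alpha> c p v = \<beta> c p v)"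

definition one_form :: "('a, 'e::euclidean_space) chart set \<Rightarrow> ('a, 'e) form \<Rightarrow> bool" where
  "one_form A \<alpha> \<longleftrightarrow>
     (\<forall>c\<in>A. \<forall>p\<in>fst c. linear (\<alpha> c p)) \<and>
     (\<forall>c\<in>A. \<forall>v. smooth_on (snd c ` fst c) (\<lambda>y. \<alpha> c (chart_inv c y) v)) \<and>
     (\<forall>c\<in>A. \<forall>c'\<in>A. \<forall>p\<in>fst c \<inter> fst c'. \<forall>v.
        \<alpha> c p v = \<alpha> c' p (frechet_derivative (snd c' \<circ> chart_inv c) (at (snd c p)) v))"

text \<open>The last clause is \<open>d\<alpha> = 0\<close>, evaluated on the constant coordinate vector fields \<open>u\<close>, \<open>v\<close>.\<close>

definition closed_forms :: "('a, 'e::euclidean_space) chart set \<Rightarrow> ('a, 'e) form set" where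
  "closed_forms A = {\<alpha>. one_form A \<alpha> \<and>
     (\<forall>c\<in>A. \<forall>y\<in>snd c ` fst c. \<forall>u v.
        frechet_derivative (\<lambda>y. \<alpha> c (chart_inv c y) v) (at y) u
        - frechet_derivative (\<lambda>y. \<alpha> c (chart_inv c y) u) (at y) v = 0)}"

definition differential :: "('a \<Rightarrow> real) \<Rightarrow> ('a, 'e::euclidean_space) form" where
  "differential f c p v = frechet_derivative (f \<circ> chart_inv c) (at (snd c p)) v"

definition chart_at :: "('a, 'e) chart set \<Rightarrow> 'a \<Rightarrow> ('a, 'e) chart" where
  "chart_at A p = (SOME c. c \<in> A \<and> p \<in> fst c)"

text \<open>The pullback along \<open>f\<close> of a one-form on a manifold with atlas \<open>B\<close>; by compatibility of the
  local expressions it does not depend on the chart picked around \<open>f p\<close>.\<close>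

definition pullback ::
  "('b, 'e::euclidean_space) chart set \<Rightarrow> ('a \<Rightarrow> 'b) \<Rightarrow> ('b, 'e) form \<Rightarrow> ('a, 'e) form" where
  "pullback B f \<alpha> c p v =
     (let c' = chart_at B (f p) in
        \<alpha> c' (f p) (frechet_derivative (snd c' \<circ> f \<circ> chart_inv c) (at (snd c p)) v))"

definition cohomologous :: "('a, 'e::euclidean_space) chart set \<Rightarrow> ('a, 'e) form rel" where
  "cohomologous A = {(\<alpha>, \<beta>). \<alpha> \<in> closed_forms A \<and> \<beta> \<in> closed_forms A \<and>
     (\<exists>f. smooth_fun A f \<and> form_eq A (\<lambda>c p v. \<beta> c p v - \<alpha> c p v) (differential f))}"

definition de_Rham_H1 :: "('a, 'e::euclidean_space) chart set \<Rightarrow> ('a, 'e) form set set" where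
  "de_Rham_H1 A = closed_forms A // cohomologous A"

definition de_Rham_class ::
  "('a, 'e::euclidean_space) chart set \<Rightarrow> ('a, 'e) form \<Rightarrow> ('a, 'e) form set" where
  "de_Rham_class A \<alpha> = cohomologous A `` {\<alpha>}"

section \<open>Fundamental group, deck transformations and periods\<close>

text \<open>Multiplication in \<open>\<pi>\<^sub>1\<close> is written like composition of maps: in \<open>\<gamma> \<otimes> \<delta>\<close> the loop \<open>\<delta>\<close> is
  traversed first. The order matters for the Bieri--Neumann--Strebel set below, whose Cayley graph
  is the one for left multiplication: passing to the opposite group replaces \<open>\<Sigma>\<close> by \<open>- \<Sigma>\<close>.\<close>

definition fundamental_group :: "'a::topological_space set \<Rightarrow> 'a \<Rightarrow> (real \<Rightarrow> 'a) set monoid" where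
  "fundamental_group X x0 =
     \<lparr>carrier = {{q. homotopic_paths X p q} | p.
        path p \<and> path_image p \<subseteq> X \<and> pathstart p = x0 \<and> pathfinish p = x0},
      mult = (\<lambda>\<gamma> \<delta>. {r. \<exists>p\<in>\<gamma>. \<exists>q\<in>\<delta>. homotopic_paths X (q +++ p) r}),
      one = {q. homotopic_paths X (\<lambda>_. x0) q}\<rparr>"

definition smooth_universal_cover ::
  "'a::topological_space set \<Rightarrow> ('a, 'e::euclidean_space) chart set \<Rightarrow>
   'b::topological_space set \<Rightarrow> ('b, 'e) chart set \<Rightarrow> ('b \<Rightarrow> 'a) \<Rightarrow> bool" where
  "smooth_universal_cover X A Y B \<pi> \<longleftrightarrow>
     smooth_manifold Y B \<and> covering_space Y \<pi> X \<and> simply_connected Y \<and>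
     local_diffeomorphism Y B X A \<pi>"

definition deck_transformations ::
  "'b::topological_space set \<Rightarrow> ('b \<Rightarrow> 'a) \<Rightarrow> ('b \<Rightarrow> 'b) set" where
  "deck_transformations Y \<pi> = {f \<in> extensional Y.
     (\<exists>g. homeomorphism Y Y f g) \<and> (\<forall>y\<in>Y. \<pi> (f y) = \<pi> y)}"

text \<open>\<open>deck_action Y \<pi> y0 \<gamma>\<close> is the inverse of the deck transformation moving \<open>y0\<close> to the end of
  the lift of \<open>\<gamma>\<close> that starts at \<open>y0\<close>. With the multiplication of \<open>fundamental_group\<close> the inverse is
  what makes this a left action.\<close>

definition deck_action ::
  "'b::topological_space set \<Rightarrow> ('b \<Rightarrow> 'a) \<Rightarrow> 'b \<Rightarrow> (real \<Rightarrow> 'a) set \<Rightarrow> 'b \<Rightarrow> 'b" where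
  "deck_action Y \<pi> y0 \<gamma> = (THE f. f \<in> deck_transformations Y \<pi> \<and>
     (\<forall>l. path l \<and> path_image l \<subseteq> Y \<and> pathstart l = y0 \<and> \<pi> \<circ> l \<in> \<gamma> \<longrightarrow> f (pathfinish l) = y0))"

text \<open>As for \<^const>\<open>piecewise_C1_differentiable_on\<close>, finitely many parameters are exempt.\<close>

definition piecewise_C1_path ::
  "'a::topological_space set \<Rightarrow> ('a, 'e::euclidean_space) chart set \<Rightarrow> (real \<Rightarrow> 'a) \<Rightarrow> bool" where
  "piecewise_C1_path X A g \<longleftrightarrow> path g \<and> path_image g \<subseteq> X \<and>
     (\<exists>K. finite K \<and> (\<forall>(U, \<phi>)\<in>A. (\<phi> \<circ> g) C1_differentiable_on {t \<in> {0..1} - K. g t \<in> U}))"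

definition line_integral ::
  "('a, 'e::euclidean_space) chart set \<Rightarrow> ('a, 'e) form \<Rightarrow> (real \<Rightarrow> 'a) \<Rightarrow> real" where
  "line_integral A \<alpha> g = integral {0..1}
     (\<lambda>t. let c = chart_at A (g t) in \<alpha> c (g t) (vector_derivative (snd c \<circ> g) (at t)))"

text \<open>The canonical identification of \<open>H\<^sup>1(X, \<real>)\<close> with the additive characters of \<open>\<pi>\<^sub>1(X, x0)\<close>:
  a class is sent to its periods. The value is independent of the representing form and loop.\<close>

definition period_character ::
  "'a::topological_space set \<Rightarrow> ('a, 'e::euclidean_space) chart set \<Rightarrow> 'a \<Rightarrow>
   ('a, 'e) form set \<Rightarrow> (real \<Rightarrow> 'a) set \<Rightarrow> real" where
  "period_character X A x0 \<xi> = (\<lambda>\<gamma>\<in>carrier (fundamental_group X x0).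
     (THE r. \<forall>\<alpha>\<in>\<xi>. \<forall>g\<in>\<gamma>. piecewise_C1_path X A g \<longrightarrow> line_integral A \<alpha> g = r))"

section \<open>Fundamental domains and taming pairs\<close>

definition fundamental_domain ::
  "('g, 'm) monoid_scheme \<Rightarrow> ('g \<Rightarrow> 'b \<Rightarrow> 'b) \<Rightarrow> 'b::topological_space set \<Rightarrow> 'b set \<Rightarrow> bool" where
  "fundamental_domain G act Y \<Phi> \<longleftrightarrow>
     openin (top_of_set Y) \<Phi> \<and>
     (top_of_set Y) interior_of ((top_of_set Y) closure_of \<Phi>) = \<Phi> \<and>
     (\<Union>g\<in>carrier G. act g ` ((top_of_set Y) closure_of \<Phi>)) = Y \<and>
     (\<forall>g\<in>carrier G - {\<one>\<^bsub>G\<^esub>}. act g ` \<Phi> \<inter> \<Phi> = {}) \<and>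
     (\<forall>y\<in>Y. \<exists>V. openin (top_of_set Y) V \<and> y \<in> V \<and>
        finite {g \<in> carrier G. act g ` ((top_of_set Y) closure_of \<Phi>) \<inter> V \<noteq> {}})"

definition geometrically_finite ::
  "('g, 'm) monoid_scheme \<Rightarrow> ('g \<Rightarrow> 'b \<Rightarrow> 'b) \<Rightarrow> 'b::topological_space set \<Rightarrow> 'b set \<Rightarrow> bool" where
  "geometrically_finite G act Y \<Phi> \<longleftrightarrow>
     finite {g \<in> carrier G - {\<one>\<^bsub>G\<^esub>}.
       act g ` ((top_of_set Y) closure_of \<Phi>) \<inter> (top_of_set Y) closure_of \<Phi> \<noteq> {}}"

definition is_primitive ::
  "('a, 'e::euclidean_space) chart set \<Rightarrow> ('b, 'e) chart set \<Rightarrow> ('b \<Rightarrow> 'a) \<Rightarrow>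
   ('a, 'e) form \<Rightarrow> ('b \<Rightarrow> real) \<Rightarrow> bool" where
  "is_primitive A B \<pi> \<alpha> h \<longleftrightarrow> smooth_fun B h \<and> form_eq B (differential h) (pullback A \<pi> \<alpha>)"

text \<open>\<open>y0 \<in> Y\<close> is the base point above \<open>x0 = \<pi> y0\<close> used to let \<open>\<pi>\<^sub>1(X, x0)\<close> act on \<open>Y\<close>.\<close>

definition taming_pair ::
  "'a::topological_space set \<Rightarrow> ('a, 'e::euclidean_space) chart set \<Rightarrow>
   'b::topological_space set \<Rightarrow> ('b, 'e) chart set \<Rightarrow> ('b \<Rightarrow> 'a) \<Rightarrow> 'b \<Rightarrow>
   ('a, 'e) form set \<Rightarrow> 'b set \<Rightarrow> ('a, 'e) form \<Rightarrow> bool" where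
  "taming_pair X A Y B \<pi> y0 \<xi> \<Phi> \<alpha> \<longleftrightarrow>
     fundamental_domain (fundamental_group X (\<pi> y0)) (deck_action Y \<pi> y0) Y \<Phi> \<and>
     \<alpha> \<in> closed_forms A \<and>
     geometrically_finite (fundamental_group X (\<pi> y0)) (deck_action Y \<pi> y0) Y \<Phi> \<and>
     de_Rham_class A \<alpha> = \<xi> \<and>
     (\<forall>h. is_primitive A B \<pi> \<alpha> h \<longrightarrow> bdd_above (h ` \<Phi>))"

section \<open>The Bieri--Neumann--Strebel set\<close>

definition additive_characters :: "('g, 'm) monoid_scheme \<Rightarrow> ('g \<Rightarrow> real) set" where
  "additive_characters G = {\<xi> \<in> extensional (carrier G).
     \<forall>g\<in>carrier G. \<forall>h\<in>carrier G. \<xi> (g \<otimes>\<^bsub>G\<^esub> h) = \<xi> g + \<xi> h}"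

definition character_ray :: "('g, 'm) monoid_scheme \<Rightarrow> ('g \<Rightarrow> real) \<Rightarrow> ('g \<Rightarrow> real) set" where
  "character_ray G \<xi> = {(\<lambda>g\<in>carrier G. r * \<xi> g) | r. r > 0}"

definition symmetric_generating_set :: "('g, 'm) monoid_scheme \<Rightarrow> 'g set \<Rightarrow> bool" where
  "symmetric_generating_set G S \<longleftrightarrow>
     S \<subseteq> carrier G \<and> (\<lambda>s. inv\<^bsub>G\<^esub> s) ` S = S \<and> generate G S = carrier G"

definition cayley_edges :: "('g, 'm) monoid_scheme \<Rightarrow> 'g set \<Rightarrow> 'g rel" where
  "cayley_edges G S = {(g, g'). g \<in> carrier G \<and> (\<exists>s\<in>S. g' = s \<otimes>\<^bsub>G\<^esub> g)}"

text \<open>Connectedness of the subgraph with edge relation \<open>E\<close> spanned by the vertex set \<open>V\<close>.\<close>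

definition spanned_connected :: "'g rel \<Rightarrow> 'g set \<Rightarrow> bool" where
  "spanned_connected E V \<longleftrightarrow> (\<forall>g\<in>V. \<forall>g'\<in>V. (g, g') \<in> (E \<inter> V \<times> V)\<^sup>*)"

definition BNS_set :: "('g, 'm) monoid_scheme \<Rightarrow> ('g \<Rightarrow> real) set set" where
  "BNS_set G = {character_ray G \<xi> | \<xi>.
     \<xi> \<in> additive_characters G \<and> (\<exists>g\<in>carrier G. \<xi> g \<noteq> 0) \<and>
     (\<exists>S. finite S \<and> symmetric_generating_set G S \<and>
        spanned_connected (cayley_edges G S) {g \<in> carrier G. \<xi> g \<ge> 0})}"

end

(* A deck transformation changes the primitive h by a period of the form, so the translates of the
   closed fundamental domain that meet the superlevel set {h >= 0} are those whose index has
   character bounded below, and two translates that touch have indices adjacent in the Cayley graph of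
   the finite set of side-pairing elements. As the superlevel set is connected and the tiling is
   locally finite, its index set is connected in that graph, up to a bounded loss in the
   character; translating on the right and adding one generator of large character removes the
   loss. The character is nonzero because otherwise h would descend to the base and make the form
   exact. *)

theory Submission
  imports Defs
begin

section \<open>Homotopies of paths in topological spaces\<close>

text \<open>An upper bound \<open>c\<close> for \<open>h\<close> on the domain works in one
  direction only: a tile that meets {h >= 0} has an index of character at least - c. Conversely, a
  single point \<open>p0\<close> of the domain shows that the tile of \<open>g\<close> meets {h >=
  0} once the character of \<open>g\<close> is at least - h p0. Indices between these thresholds may
  belong to tiles that miss the superlevel set; this gap is what the extra generator has to bridge.
  Connectedness enters without any path in the superlevel set: local finiteness makes every union of
  tiles closed, so a component of indices and its complement would split the set into two closed
  pieces. Finite generation of the group comes out of the same argument, since walks from the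
  identity spell words. Periods are integrals over piecewise C1 loops, whereas homotopy classes
  consist of continuous ones; hence the effort to join any two points of the cover by a path with
  piecewise C1 projection. The action is by inverses of the usual deck transformations, so
  \<open>h\<close> drops by the period: h (act g y) = h y - \<theta> g.\<close>

lemma pathstart_const [simp]: "pathstart (\<lambda>_. x) = x"
  by (simp add: pathstart_def)

lemma pathfinish_const [simp]: "pathfinish (\<lambda>_. x) = x"
  by (simp add: pathfinish_def)

text \<open>Reparametrisations are handled in the parameter domain: two paths in a convex set with
  common ends are homotopic there, and \<open>F\<close> carries the homotopy over. With the unit
  interval and a path as \<open>F\<close> this yields the cancellation laws below; with the unit
  square it compares ways around the boundary.\<close>

lemma homotopic_paths_via_convex:
  fixes F :: "'c::real_normed_vector \<Rightarrow> 'a::topological_space"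
  assumes "convex Q" "continuous_on Q F" "F ` Q \<subseteq> S"
    and "path p" "path_image p \<subseteq> Q" "path q" "path_image q \<subseteq> Q"
    and "pathstart q = pathstart p" "pathfinish q = pathfinish p"
  shows "homotopic_paths S (F \<circ> p) (F \<circ> q)"
proof -
  have "homotopic_paths Q p q"
    using convex_imp_simply_connected[OF \<open>convex Q\<close>] assms
    by (simp add: simply_connected_eq_homotopic_paths)
  then show ?thesis
    using assms(2,3) by (auto intro: homotopic_paths_continuous_image)
qed

lemma compose_linepath_0_1: "f \<circ> linepath (0::real) 1 = f"
  by (auto simp: linepath_def)

lemma compose_linepath_same: "f \<circ> linepath a a = (\<lambda>_. f a)"
  by (auto simp: linepath_refl)

text \<open>The path is \<open>p \<circ> linepath 0 1\<close> and the constant tail is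
  \<open>p \<circ> linepath 1 1\<close>, so both sides come from parameter paths from 0 to 1 inside
  the interval. The variants for a constant head and for a reversed path differ only in the
  parameter path.\<close>

lemma homotopic_paths_join_const_right:
  fixes p :: "real \<Rightarrow> 'a::topological_space"
  assumes "path p" "path_image p \<subseteq> S" "x = pathfinish p"
  shows "homotopic_paths S (p +++ (\<lambda>_. x)) p"
proof -
  have "homotopic_paths S (p \<circ> (linepath 0 1 +++ linepath 1 1)) (p \<circ> linepath 0 1)"
    by (rule homotopic_paths_via_convex[where Q = "{0..1}"])
      (use assms in \<open>auto simp: path_def path_image_def path_image_join closed_segment_eq_real_ivl
         simp flip: path_image_def path_def\<close>)
  then show ?thesis
    using assms(3) by (simp add: path_compose_join compose_linepath_0_1 compose_linepath_same pathfinish_def)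
qed

lemma homotopic_paths_join_const_left:
  fixes p :: "real \<Rightarrow> 'a::topological_space"
  assumes "path p" "path_image p \<subseteq> S" "x = pathstart p"
  shows "homotopic_paths S ((\<lambda>_. x) +++ p) p"
proof -
  have "homotopic_paths S (p \<circ> (linepath 0 0 +++ linepath 0 1)) (p \<circ> linepath 0 1)"
    by (rule homotopic_paths_via_convex[where Q = "{0..1}"])
      (use assms in \<open>auto simp: path_def path_image_def path_image_join closed_segment_eq_real_ivl
         simp flip: path_image_def path_def\<close>)
  then show ?thesis
    using assms(3) by (simp add: path_compose_join compose_linepath_0_1 compose_linepath_same pathstart_def)
qed

lemma homotopic_paths_join_reversepath:
  fixes p :: "real \<Rightarrow> 'a::topological_space"
  assumes "path p" "path_image p \<subseteq> S"
  shows "homotopic_paths S (p +++ reversepath p) (\<lambda>_. pathstart p)"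
proof -
  have "homotopic_paths S (p \<circ> (linepath 0 1 +++ linepath 1 0)) (p \<circ> linepath 0 0)"
    by (rule homotopic_paths_via_convex[where Q = "{0..1}"])
      (use assms in \<open>auto simp: path_def path_image_def path_image_join closed_segment_eq_real_ivl
         simp flip: path_image_def path_def\<close>)
  moreover have "p \<circ> linepath 1 0 = reversepath p"
    by (auto simp: linepath_def reversepath_def)
  ultimately show ?thesis
    by (simp add: path_compose_join compose_linepath_0_1 compose_linepath_same pathstart_def)
qed

lemma homotopic_paths_reversepath_join:
  fixes p :: "real \<Rightarrow> 'a::topological_space"
  assumes "path p" "path_image p \<subseteq> S"
  shows "homotopic_paths S (reversepath p +++ p) (\<lambda>_. pathfinish p)"
  using homotopic_paths_join_reversepath[of "reversepath p" S] assms by simp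

text \<open>The hypothesis provides only a free homotopy of loops, during which the base point may
  wander. Its track \<open>?c\<close> is the bottom edge of the square and \<open>p\<close> is the
  left edge; going round the other three edges shows that \<open>p\<close> is homotopic to
  \<open>?c\<close> followed by its reverse, which cancels.\<close>

lemma simply_connected_null_homotopic:
  fixes p :: "real \<Rightarrow> 'a::topological_space"
  assumes S: "simply_connected S" and p: "path p" "path_image p \<subseteq> S" "pathfinish p = pathstart p"
  shows "homotopic_paths S p (\<lambda>_. pathstart p)"
proof -
  let ?k = "\<lambda>_::real. pathstart p"
  let ?Q = "{0..1::real} \<times> {0..1::real}"
  have xS: "pathstart p \<in> S"
    using p(2) pathstart_in_path_image by blast
  have "path ?k \<and> pathfinish ?k = pathstart ?k \<and> path_image ?k \<subseteq> S"
    using xS by (auto simp: path_def pathfinish_def pathstart_def path_image_def)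
  then have "homotopic_loops S p ?k"
    using S p unfolding simply_connected_def by blast
  then obtain h where h: "continuous_on ?Q h" "h \<in> ?Q \<rightarrow> S"
    and h0: "\<And>x. x \<in> {0..1} \<Longrightarrow> h (0, x) = p x"
    and h1: "\<And>x. x \<in> {0..1} \<Longrightarrow> h (1, x) = pathstart p"
    and hl: "\<And>t. t \<in> {0..1} \<Longrightarrow> h (t, 1) = h (t, 0)"
    unfolding homotopic_loops by (auto simp: pathstart_def pathfinish_def)
  have cvx: "convex ?Q"
    by (intro convex_Times) auto
  have seg: "closed_segment a b \<subseteq> ?Q" if "a \<in> ?Q" "b \<in> ?Q" for a b
    using closed_segment_subset[OF that cvx] .
  let ?c = "h \<circ> linepath (0, 0) (1, 0)"
  let ?m = "h \<circ> linepath (1, 0) (1, 1)"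
  let ?d = "h \<circ> linepath (1, 1) (0, 1)"
  have hsub: "h ` ?Q \<subseteq> S" using h(2) by blast
  have him: "path_image (h \<circ> linepath a b) \<subseteq> S" if "a \<in> ?Q" "b \<in> ?Q" for a b
    using image_mono[OF seg[OF that], of h] hsub by (simp add: path_image_compose)
  have 1: "homotopic_paths S (h \<circ> linepath (0, 0) (0, 1))
      (h \<circ> (linepath (0, 0) (1, 0) +++ (linepath (1, 0) (1, 1) +++ linepath (1, 1) (0, 1))))"
    by (rule homotopic_paths_via_convex[OF cvx h(1) hsub])
      (simp_all add: path_image_join seg)
  have pc: "path ?c" "path_image ?c \<subseteq> S"
    using hsub seg[of "(0,0)" "(1,0)"]
    by (auto intro!: path_continuous_image continuous_on_subset[OF h(1)] simp: path_image_compose)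
  have linj: "linepath (1::real, 0::real) (1, 1) x = (1, x)" "linepath (1, 1) (0::real, 1::real) x = (1 - x, 1)"
    "linepath (0::real, 0::real) (1, 0) x = (x, 0)" "linepath (0::real, 0::real) (0, 1) x = (0, x)" for x :: real
    by (auto simp: linepath_def)
  have pk: "h (1, 0) = pathstart p"
    by (simp add: h1)
  \<comment> \<open>The right edge is constant by \<open>h1\<close>; by \<open>hl\<close> the top
    edge repeats the bottom one, so traversed backwards it is the reverse of
    \<open>?c\<close>.\<close>
  have 2: "homotopic_paths S (?m +++ ?d) ((\<lambda>_. pathstart p) +++ reversepath ?c)"
  proof (rule homotopic_paths_eq)
    have "path (h \<circ> (linepath (1, 0) (1, 1) +++ linepath (1, 1) (0, 1)))"
      using seg by (intro path_continuous_image continuous_on_subset[OF h(1)]) (simp_all add: path_image_join)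
    then show "path (?m +++ ?d)"
      by (simp add: path_compose_join)
    show "path_image (?m +++ ?d) \<subseteq> S"
      by (intro subset_path_image_join him) auto
    show "(?m +++ ?d) t = ((\<lambda>_. pathstart p) +++ reversepath ?c) t" if "t \<in> {0..1}" for t
      using that h1[of "2 * t"] hl[of "2 - 2 * t"]
      by (auto simp: joinpaths_def reversepath_def linj)
  qed
  have sc: "pathstart (reversepath ?c) = pathstart p"
    by (simp add: pathfinish_def linj pk)
  have 3: "homotopic_paths S ((\<lambda>_. pathstart p) +++ reversepath ?c) (reversepath ?c)"
    using pc sc by (intro homotopic_paths_join_const_left) auto
  have 4: "homotopic_paths S (?c +++ (?m +++ ?d)) (?c +++ reversepath ?c)"
    using pc by (intro homotopic_paths_join homotopic_paths_trans[OF 2 3])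
      (auto simp: pathfinish_def pathstart_def joinpaths_def linj)
  have 5: "homotopic_paths S (?c +++ reversepath ?c) (\<lambda>_. pathstart p)"
  proof -
    have "pathstart ?c = pathstart p"
      by (simp add: pathstart_def linj h0)
    then show ?thesis
      using homotopic_paths_join_reversepath[OF pc] by simp
  qed
  have "homotopic_paths S p (h \<circ> linepath (0, 0) (0, 1))"
    using p by (intro homotopic_paths_eq) (auto simp: linj h0)
  also have "homotopic_paths S (h \<circ> linepath (0, 0) (0, 1)) (?c +++ (?m +++ ?d))"
    using 1 by (simp add: path_compose_join)
  finally show ?thesis
    using 4 5 homotopic_paths_trans by blast
qed

text \<open>Insert \<open>reversepath q +++ q\<close> after \<open>p\<close> and reassociate: the
  loop \<open>p +++ reversepath q\<close> is null-homotopic, which leaves \<open>q\<close>.\<close>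

lemma simply_connected_homotopic_paths:
  fixes p q :: "real \<Rightarrow> 'a::topological_space"
  assumes S: "simply_connected S" and p: "path p" "path_image p \<subseteq> S" and q: "path q" "path_image q \<subseteq> S"
    and pq: "pathstart q = pathstart p" "pathfinish q = pathfinish p"
  shows "homotopic_paths S p q"
proof -
  have "homotopic_paths S (p +++ (reversepath q +++ q)) (p +++ (\<lambda>_. pathfinish q))"
    using p q pq by (intro homotopic_paths_join homotopic_paths_reversepath_join) auto
  moreover have "homotopic_paths S (p +++ (\<lambda>_. pathfinish q)) p"
    using p pq by (intro homotopic_paths_join_const_right) auto
  moreover have "homotopic_paths S (p +++ (reversepath q +++ q)) ((p +++ reversepath q) +++ q)"
    using p q pq by (intro homotopic_paths_assoc) auto
  moreover have "homotopic_paths S ((p +++ reversepath q) +++ q) ((\<lambda>_. pathstart p) +++ q)"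
  proof (intro homotopic_paths_join)
    show "homotopic_paths S (p +++ reversepath q) (\<lambda>_. pathstart p)"
      using simply_connected_null_homotopic[OF S, of "p +++ reversepath q"] p q pq
      by (simp add: subset_path_image_join)
  qed (use p q pq in auto)
  moreover have "homotopic_paths S ((\<lambda>_. pathstart p) +++ q) q"
    using q pq by (intro homotopic_paths_join_const_left) auto
  ultimately show ?thesis
    by (meson homotopic_paths_sym homotopic_paths_trans)
qed

text \<open>Simple connectedness compares loops without a common base point, so the constant loops
  at \<open>x\<close> and \<open>y\<close> are freely homotopic; the track of parameter 0 joins the
  two points.\<close>

lemma simply_connected_path_connected:
  fixes S :: "'a::topological_space set"
  assumes "simply_connected S"
  shows "path_connected S"
  unfolding path_connected_def
proof (intro ballI)
  fix x y assume xy: "x \<in> S" "y \<in> S"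
  have "homotopic_loops S (\<lambda>_. x) (\<lambda>_. y)"
    using assms[unfolded simply_connected_def, rule_format, of "\<lambda>_. x" "\<lambda>_. y"] xy
    by (auto simp: path_def path_image_def)
  then obtain h where h: "continuous_on ({0..1} \<times> {0..1}) h" "h \<in> {0..1} \<times> {0..1} \<rightarrow> S"
    and h0: "\<And>t. t \<in> {0..1} \<Longrightarrow> h (0, t) = x" and h1: "\<And>t. t \<in> {0..1} \<Longrightarrow> h (1::real, t::real) = y"
    unfolding homotopic_loops by auto
  have "path (\<lambda>s. h (s, 0))"
    unfolding path_def by (rule continuous_on_compose2[OF h(1)]) (auto intro!: continuous_intros)
  moreover have "path_image (\<lambda>s. h (s, 0)) \<subseteq> S"
    using h(2) by (auto simp: path_image_def)
  ultimately show "\<exists>g. path g \<and> path_image g \<subseteq> S \<and> pathstart g = x \<and> pathfinish g = y"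
    using h0[of 0] h1[of 0] by (intro exI[of _ "\<lambda>s. h (s, 0)"]) (auto simp: pathstart_def pathfinish_def)
qed

section \<open>Lifting along coverings\<close>

text \<open>The lifting theorems of \<^theory>\<open>HOL-Analysis.Homeomorphism\<close> are stated for normed spaces only.\<close>

lemma covering_space_evenly_covered:
  assumes "covering_space C p S" "x \<in> S"
  obtains W v where "x \<in> W" "openin (top_of_set S) W" "\<Union>v = C \<inter> p -` W"
    "\<And>u. u \<in> v \<Longrightarrow> openin (top_of_set C) u" "pairwise disjnt v"
    "\<And>u. u \<in> v \<Longrightarrow> \<exists>q. homeomorphism u W p q"
proof -
  have "\<forall>x\<in>S. \<exists>T. x \<in> T \<and> openin (top_of_set S) T \<and>
      (\<exists>v. \<Union>v = C \<inter> p -` T \<and> (\<forall>u\<in>v. openin (top_of_set C) u) \<and> pairwise disjnt v \<and>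
        (\<forall>u\<in>v. \<exists>q. homeomorphism u T p q))"
    using assms(1) unfolding covering_space_def by (elim conjE)
  from bspec[OF this assms(2)] show ?thesis
    by (elim exE conjE) (rule that, auto)
qed

text \<open>The coincidence set is clopen in the connected \<open>T\<close>. Near a given point each
  lift stays in one sheet over a common evenly covered set: if the sheets are equal, injectivity of
  \<open>p\<close> there forces agreement, and if not, they are disjoint.\<close>

lemma covering_space_unique_lift:
  fixes p :: "'b::topological_space \<Rightarrow> 'a::topological_space" and g1 g2 :: "'c::topological_space \<Rightarrow> 'b"
  assumes cov: "covering_space C p S" and T: "connected T"
    and g1: "continuous_on T g1" "g1 ` T \<subseteq> C" and g2: "continuous_on T g2" "g2 ` T \<subseteq> C"
    and eq: "\<And>x. x \<in> T \<Longrightarrow> p (g1 x) = p (g2 x)"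
    and a: "a \<in> T" "g1 a = g2 a" and x: "x \<in> T"
  shows "g1 x = g2 x"
proof -
  have nbhd: "\<exists>N. openin (top_of_set T) N \<and> z \<in> N \<and>
      (\<forall>w\<in>N. g1 w = g2 w \<longleftrightarrow> g1 z = g2 z)" if z: "z \<in> T" for z
  proof -
    have zS: "p (g1 z) \<in> S"
      using covering_space_imp_surjective[OF cov] g1(2) z by auto
    obtain W v where W: "p (g1 z) \<in> W" and v: "\<Union>v = C \<inter> p -` W"
      and vo: "\<And>u. u \<in> v \<Longrightarrow> openin (top_of_set C) u" and dj: "pairwise disjnt v"
      and hom: "\<And>u. u \<in> v \<Longrightarrow> \<exists>q. homeomorphism u W p q"
      using covering_space_evenly_covered[OF cov zS] by metis
    have "g1 z \<in> \<Union>v" "g2 z \<in> \<Union>v"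
      using W z g1 g2 eq[OF z] v by auto
    then obtain u1 u2 where u: "u1 \<in> v" "u2 \<in> v" "g1 z \<in> u1" "g2 z \<in> u2"
      by blast
    have inj: "inj_on p u1"
      using hom[OF u(1)] by (metis homeomorphism_def inj_on_inverseI)
    define N where "N = (T \<inter> g1 -` u1) \<inter> (T \<inter> g2 -` u2)"
    have "openin (top_of_set T) N"
      unfolding N_def using g1 g2 vo u
      by (intro openin_Int continuous_openin_preimage[where T = C]) auto
    moreover have "z \<in> N"
      using u z by (auto simp: N_def)
    moreover have "g1 w = g2 w \<longleftrightarrow> g1 z = g2 z" if w: "w \<in> N" for w
    proof (cases "u1 = u2")
      case True
      then show ?thesis
        using inj u w eq[OF z] eq[of w] unfolding inj_on_def N_def by auto
    next
      case False
      then have "disjnt u1 u2"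
        using dj u by (auto simp: pairwise_def)
      then show ?thesis
        using u w by (auto simp: N_def disjnt_def)
    qed
    ultimately show ?thesis by blast
  qed
  have op: "openin (top_of_set T) {x \<in> T. P x}"
    if P: "\<And>z. z \<in> T \<Longrightarrow> \<exists>N. openin (top_of_set T) N \<and> z \<in> N \<and> (\<forall>w\<in>N. P w \<longleftrightarrow> P z)" for P
  proof (subst openin_subopen, intro ballI)
    fix z assume z: "z \<in> {x \<in> T. P x}"
    then obtain N where "openin (top_of_set T) N" "z \<in> N" "\<forall>w\<in>N. P w \<longleftrightarrow> P z"
      using P[of z] by blast
    then show "\<exists>N. openin (top_of_set T) N \<and> z \<in> N \<and> N \<subseteq> {x \<in> T. P x}"
      using z openin_imp_subset by (intro exI[of _ N]) blast
  qed
  have "openin (top_of_set T) {x \<in> T. g1 x = g2 x}"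
    by (rule op[OF nbhd])
  moreover have "openin (top_of_set T) {x \<in> T. g1 x \<noteq> g2 x}"
    using nbhd by (intro op) metis
  moreover have "T - {x \<in> T. g1 x = g2 x} = {x \<in> T. g1 x \<noteq> g2 x}"
    by auto
  ultimately have "closedin (top_of_set T) {x \<in> T. g1 x = g2 x}"
    by (auto simp: closedin_def)
  with \<open>openin (top_of_set T) {x \<in> T. g1 x = g2 x}\<close> have "{x \<in> T. g1 x = g2 x} = {} \<or> {x \<in> T. g1 x = g2 x} = T"
    using T connected_clopen by blast
  then show ?thesis
    using a x by blast
qed

text \<open>The prescribed value sits at an arbitrary point \<open>a\<close> of \<open>R\<close>,
  not at a fixed corner, so that a lift on one piece can be continued on the next from any common
  point.\<close>

definition lifts_over ::
  "'b::topological_space set \<Rightarrow> ('b \<Rightarrow> 'a::topological_space) \<Rightarrow> ('c::topological_space \<Rightarrow> 'a) \<Rightarrow> 'c set \<Rightarrow> bool" where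
  "lifts_over C p F R \<longleftrightarrow> (\<forall>a\<in>R. \<forall>y\<in>C. p y = F a \<longrightarrow>
     (\<exists>G. continuous_on R G \<and> G ` R \<subseteq> C \<and> (\<forall>x\<in>R. p (G x) = F x) \<and> G a = y))"

text \<open>A lift on one piece is continued through a point of the overlap; the two lifts agree on
  the whole overlap because it is connected, and pasting along closed sets applies.\<close>

lemma lifts_over_Un:
  fixes p :: "'b::topological_space \<Rightarrow> 'a::topological_space" and F :: "'c::topological_space \<Rightarrow> 'a"
  assumes cov: "covering_space C p S" and cl: "closed A" "closed B"
    and con: "connected (A \<inter> B)" "A \<inter> B \<noteq> {}"
    and A: "lifts_over C p F A" and B: "lifts_over C p F B"
  shows "lifts_over C p F (A \<union> B)"
proof -
  have *: "\<exists>G. continuous_on (A \<union> B) G \<and> G ` (A \<union> B) \<subseteq> C \<and> (\<forall>x\<in>A \<union> B. p (G x) = F x) \<and> G a = y"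
    if cl: "closed A" "closed B" and con: "connected (A \<inter> B)" "A \<inter> B \<noteq> {}"
      and A: "lifts_over C p F A" and B: "lifts_over C p F B" and a: "a \<in> A" "y \<in> C" "p y = F a"
    for A B a y
  proof -
    obtain G1 where G1: "continuous_on A G1" "G1 ` A \<subseteq> C" "\<And>x. x \<in> A \<Longrightarrow> p (G1 x) = F x" "G1 a = y"
      using A a unfolding lifts_over_def by meson
    obtain e where e: "e \<in> A" "e \<in> B"
      using con by blast
    obtain G2 where G2: "continuous_on B G2" "G2 ` B \<subseteq> C" "\<And>x. x \<in> B \<Longrightarrow> p (G2 x) = F x" "G2 e = G1 e"
      using B e G1(2,3) unfolding lifts_over_def by (metis image_subset_iff)
    have agree: "G1 x = G2 x" if "x \<in> A" "x \<in> B" for x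
      using G1 G2 e that
      by (intro covering_space_unique_lift[OF cov con(1), of G1 G2 e x])
        (auto intro: continuous_on_subset)
    define G where "G x = (if x \<in> A then G1 x else G2 x)" for x
    have "continuous_on (A \<union> B) G"
      unfolding G_def using cl G1 G2 agree by (intro continuous_on_cases) auto
    then show ?thesis
      using G1 G2 a by (intro exI[of _ G]) (auto simp: G_def)
  qed
  \<comment> \<open>The auxiliary fact starts in the first set; exchanging the two sets covers a
    starting point in the second.\<close>
  show ?thesis
    unfolding lifts_over_def
    using *[OF cl con A B] *[of B A] cl con A B by (auto simp: Int_commute Un_commute)
qed

text \<open>The rectangle is so small that \<open>F\<close> maps it into one evenly covered set,
  where a lift is \<open>F\<close> followed by the inverse of \<open>p\<close> on the right sheet.
  \<open>F\<close> lives on the whole plane because the bisection principle also tests rectangles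
  that stick out of the unit square.\<close>

lemma lifts_over_local:
  fixes p :: "'b::topological_space \<Rightarrow> 'a::topological_space" and F :: "real \<times> real \<Rightarrow> 'a"
  assumes cov: "covering_space C p S" and F: "continuous_on UNIV F" "range F \<subseteq> S"
  shows "\<exists>\<delta>>0. \<forall>a b c d. a \<le> s \<and> s \<le> b \<and> b - a < \<delta> \<and> c \<le> t \<and> t \<le> d \<and> d - c < \<delta> \<longrightarrow>
           lifts_over C p F ({a..b} \<times> {c..d})"
proof -
  have "F (s, t) \<in> S" using F by auto
  then obtain W v where W: "F (s, t) \<in> W" "openin (top_of_set S) W" and v: "\<Union>v = C \<inter> p -` W"
    and hom: "\<And>u. u \<in> v \<Longrightarrow> \<exists>q. homeomorphism u W p q"
    using covering_space_evenly_covered[OF cov] by metis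
  obtain U where U: "open U" "W = S \<inter> U"
    using W(2) by (auto simp: openin_open)
  have "open (F -` U)"
    using F(1) U(1) by (simp add: continuous_on_open_vimage)
  moreover have "(s, t) \<in> F -` U"
    using W U by auto
  ultimately obtain e where e: "e > 0" "ball (s, t) e \<subseteq> F -` U"
    using open_contains_ball by blast
  show ?thesis
  proof (intro exI[of _ "e / 2"] conjI allI impI)
    show "e / 2 > 0" using e by simp
    fix a b c d
    assume *: "a \<le> s \<and> s \<le> b \<and> b - a < e / 2 \<and> c \<le> t \<and> t \<le> d \<and> d - c < e / 2"
    have R: "F z \<in> W" if z: "z \<in> {a..b} \<times> {c..d}" for z
    proof -
      have "dist (s, t) z \<le> \<bar>s - fst z\<bar> + \<bar>t - snd z\<bar>"
        using norm_Pair_le[of "s - fst z" "t - snd z"] by (cases z) (simp add: dist_norm)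
      also have "\<dots> < e"
        using * z by (cases z) auto
      finally have "z \<in> F -` U"
        using e by auto
      then show ?thesis using F U by auto
    qed
    show "lifts_over C p F ({a..b} \<times> {c..d})"
      unfolding lifts_over_def
    proof (intro ballI impI)
      fix z y assume z: "z \<in> {a..b} \<times> {c..d}" and y: "y \<in> C" "p y = F z"
      have "y \<in> \<Union>v" using v y R[OF z] by auto
      then obtain u where u: "u \<in> v" "y \<in> u" by blast
      then obtain q where q: "homeomorphism u W p q" using hom by blast
      show "\<exists>G. continuous_on ({a..b} \<times> {c..d}) G \<and> G ` ({a..b} \<times> {c..d}) \<subseteq> C \<and>
          (\<forall>x\<in>{a..b} \<times> {c..d}. p (G x) = F x) \<and> G z = y"
      proof (intro exI[of _ "q \<circ> F"] conjI ballI)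
        show "continuous_on ({a..b} \<times> {c..d}) (q \<circ> F)"
          using q R F(1) unfolding homeomorphism_def
          by (intro continuous_on_compose) (auto intro: continuous_on_subset)
        show "(q \<circ> F) ` ({a..b} \<times> {c..d}) \<subseteq> C"
          using q R u v unfolding homeomorphism_def by fastforce
        show "p ((q \<circ> F) x) = F x" if "x \<in> {a..b} \<times> {c..d}" for x
          using q R[OF that] unfolding homeomorphism_def by auto
        show "(q \<circ> F) z = y"
          using q u y unfolding homeomorphism_def by (metis comp_apply)
      qed
    qed
  qed
qed

text \<open>The square is cut into thin strips, and each strip into small rectangles.\<close>

lemma lifts_over_square:
  fixes p :: "'b::topological_space \<Rightarrow> 'a::topological_space" and F :: "real \<times> real \<Rightarrow> 'a"
  assumes cov: "covering_space C p S" and F: "continuous_on UNIV F" "range F \<subseteq> S"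
  shows "lifts_over C p F ({0..1} \<times> {0..1})"
proof -
  define P where "P a b \<longleftrightarrow> lifts_over C p F ({a..b} \<times> {0..1})" for a b
  have "P 0 1"
  proof (rule Bolzano)
    show "P a c" if "P a b" "P b c" "a \<le> b" "b \<le> c" for a b c
    proof -
      have "{a..b} \<times> {0..1::real} \<inter> {b..c} \<times> {0..1} = {b} \<times> {0..1}"
        using that by auto
      moreover have "{a..b} \<times> {0..1::real} \<union> {b..c} \<times> {0..1} = {a..c} \<times> {0..1}"
        using that by auto
      ultimately show ?thesis
        using lifts_over_Un[OF cov, of "{a..b} \<times> {0..1}" "{b..c} \<times> {0..1}" F] that
        by (auto simp: P_def closed_Times connected_Times)
    qed
    fix s :: real
    \<comment> \<open>Bisection in the second coordinate, with \<open>s\<close> fixed. The strip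
      width is quantified inside \<open>Q\<close>, since each piece brings its own width and gluing
      takes the smaller one; in the end it is the width that the outer bisection asks for.\<close>
    define Q where "Q c d \<longleftrightarrow> (\<exists>\<delta>>0. \<forall>a b. a \<le> s \<and> s \<le> b \<and> b - a < \<delta> \<longrightarrow>
      lifts_over C p F ({a..b} \<times> {c..d}))" for c d
    have "Q 0 1"
    proof (rule Bolzano)
      show "Q c e" if Q: "Q c d" "Q d e" and cde: "c \<le> d" "d \<le> e" for c d e
      proof -
        obtain \<delta>1 \<delta>2 where \<delta>: "\<delta>1 > 0" "\<delta>2 > 0"
          and 1: "\<And>a b. a \<le> s \<and> s \<le> b \<and> b - a < \<delta>1 \<Longrightarrow> lifts_over C p F ({a..b} \<times> {c..d})"
          and 2: "\<And>a b. a \<le> s \<and> s \<le> b \<and> b - a < \<delta>2 \<Longrightarrow> lifts_over C p F ({a..b} \<times> {d..e})"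
          using Q unfolding Q_def by metis
        have "lifts_over C p F ({a..b} \<times> {c..e})" if ab: "a \<le> s" "s \<le> b" "b - a < min \<delta>1 \<delta>2" for a b
        proof -
          have "{a..b} \<times> {c..d} \<inter> {a..b} \<times> {d..e} = {a..b} \<times> {d}"
            using cde by auto
          moreover have "{a..b} \<times> {c..d} \<union> {a..b} \<times> {d..e} = {a..b} \<times> {c..e}"
            using cde by auto
          ultimately show ?thesis
            using lifts_over_Un[OF cov, of "{a..b} \<times> {c..d}" "{a..b} \<times> {d..e}" F] 1[of a b] 2[of a b] ab
            by (auto simp: closed_Times connected_Times)
        qed
        then show ?thesis
          unfolding Q_def using \<delta> by (intro exI[of _ "min \<delta>1 \<delta>2"]) auto
      qed
      fix t :: real
      show "\<exists>d>0. \<forall>a b. a \<le> t \<and> t \<le> b \<and> b - a < d \<longrightarrow> Q a b"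
      proof -
        obtain \<delta> where "\<delta> > 0" and \<delta>: "\<And>a b c d. a \<le> s \<and> s \<le> b \<and> b - a < \<delta> \<and> c \<le> t \<and> t \<le> d \<and> d - c < \<delta> \<Longrightarrow>
           lifts_over C p F ({a..b} \<times> {c..d})"
          using lifts_over_local[OF cov F, of s t] by auto
        have "Q c d" if "c \<le> t \<and> t \<le> d \<and> d - c < \<delta>" for c d
          unfolding Q_def using that \<open>\<delta> > 0\<close> by (intro exI[of _ \<delta>]) (auto intro!: \<delta>)
        then show ?thesis
          using \<open>\<delta> > 0\<close> by blast
      qed
    qed simp
    then show "\<exists>d>0. \<forall>a b. a \<le> s \<and> s \<le> b \<and> b - a < d \<longrightarrow> P a b"
      unfolding Q_def P_def .
  qed simp
  then show ?thesis by (simp add: P_def)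
qed

lemma covering_space_lift_square:
  fixes p :: "'b::topological_space \<Rightarrow> 'a::topological_space" and F :: "real \<times> real \<Rightarrow> 'a"
  assumes cov: "covering_space C p S" and F: "continuous_on ({0..1} \<times> {0..1}) F" "F ` ({0..1} \<times> {0..1}) \<subseteq> S"
    and y: "y \<in> C" "p y = F (0, 0)"
  obtains G where "continuous_on ({0..1} \<times> {0..1}) G" "G ` ({0..1} \<times> {0..1}) \<subseteq> C"
    "\<And>z. z \<in> {0..1} \<times> {0..1} \<Longrightarrow> p (G z) = F z" "G (0, 0) = y"
proof -
  \<comment> \<open>\<open>cl\<close> clamps the plane to the unit square, so that
    \<open>F \<circ> cl\<close> extends \<open>F\<close> to the plane without leaving
    \<open>S\<close>.\<close>
  define cl :: "real \<times> real \<Rightarrow> real \<times> real" where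
    "cl z = (max 0 (min 1 (fst z)), max 0 (min 1 (snd z)))" for z
  have cl: "cl z \<in> {0..1} \<times> {0..1}" for z
    by (auto simp: cl_def)
  have clid: "cl z = z" if "z \<in> {0..1} \<times> {0..1}" for z
    using that by (auto simp: cl_def)
  have "continuous_on UNIV cl"
    unfolding cl_def by (intro continuous_intros)
  then have "continuous_on UNIV (F \<circ> cl)"
    using cl by (intro continuous_on_compose continuous_on_subset[OF F(1)] image_subsetI)
  moreover have "range (F \<circ> cl) \<subseteq> S"
    using F(2) cl by (intro image_subsetI) (metis comp_apply image_subset_iff)
  ultimately have "lifts_over C p (F \<circ> cl) ({0..1} \<times> {0..1})"
    by (rule lifts_over_square[OF cov])
  from this[unfolded lifts_over_def, THEN bspec[of _ _ "(0, 0)"], THEN bspec[OF _ y(1)]]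
  obtain G where "continuous_on ({0..1} \<times> {0..1}) G" "G ` ({0..1} \<times> {0..1}) \<subseteq> C"
    "\<forall>x\<in>{0..1} \<times> {0..1}. p (G x) = (F \<circ> cl) x" "G (0, 0) = y"
    using y clid[of "(0, 0)"] by auto
  then show ?thesis
    using that clid by (metis comp_apply)
qed

text \<open>A path is viewed as a map on the square that ignores the first coordinate; the left edge
  of the lifted square is the lift.\<close>

lemma covering_space_path_lift:
  fixes p :: "'b::topological_space \<Rightarrow> 'a::topological_space"
  assumes cov: "covering_space C p S" and g: "path g" "path_image g \<subseteq> S" and y: "y \<in> C" "p y = pathstart g"
  obtains l where "path l" "path_image l \<subseteq> C" "pathstart l = y" "\<And>t. t \<in> {0..1} \<Longrightarrow> p (l t) = g t"
proof -
  have "continuous_on ({0..1::real} \<times> {0..1}) (g \<circ> snd)"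
    using g by (intro continuous_on_compose continuous_intros) (auto simp: path_def snd_image_times)
  moreover have "(g \<circ> snd) ` ({0..1::real} \<times> {0..1}) \<subseteq> S"
    using g(2) by (auto simp: path_image_def)
  moreover have "p y = (g \<circ> snd) (0::real, 0)"
    using y(2) by (simp add: pathstart_def)
  ultimately obtain G where G: "continuous_on ({0..1::real} \<times> {0..1}) G" "G ` ({0..1} \<times> {0..1}) \<subseteq> C"
    "\<And>z. z \<in> {0..1} \<times> {0..1} \<Longrightarrow> p (G z) = (g \<circ> snd) z" "G (0, 0) = y"
    using covering_space_lift_square[OF cov _ _ y(1)] by blast
  show ?thesis
  proof (rule that[of "\<lambda>t. G (0, t)"])
    show "path (\<lambda>t. G (0, t))"
      unfolding path_def by (rule continuous_on_compose2[OF G(1)]) (auto intro!: continuous_intros)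
  qed (use G in \<open>auto simp: pathstart_def path_image_def\<close>)
qed

text \<open>Lift the homotopy. Its edge of starting points lifts a constant and so is constant;
  unique lifting then identifies the sides at 0 and 1 with \<open>l1\<close> and \<open>l2\<close>,
  and the edge of end points is constant as well.\<close>

lemma covering_space_homotopic_lifts:
  fixes p :: "'b::topological_space \<Rightarrow> 'a::topological_space"
  assumes cov: "covering_space C p S" and hom: "homotopic_paths S g1 g2"
    and l1: "path l1" "path_image l1 \<subseteq> C" "\<And>t. t \<in> {0..1} \<Longrightarrow> p (l1 t) = g1 t"
    and l2: "path l2" "path_image l2 \<subseteq> C" "\<And>t. t \<in> {0..1} \<Longrightarrow> p (l2 t) = g2 t"
    and start: "pathstart l1 = pathstart l2"
  shows "pathfinish l1 = pathfinish l2"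
proof -
  obtain h :: "real \<times> real \<Rightarrow> 'a" where h: "continuous_on ({0..1} \<times> {0..1}) h" "h \<in> {0..1} \<times> {0..1} \<rightarrow> S"
    and h0: "\<And>x. x \<in> {0..1} \<Longrightarrow> h (0, x) = g1 x" and h1: "\<And>x. x \<in> {0..1} \<Longrightarrow> h (1, x) = g2 x"
    and ends: "\<And>t. t \<in> {0..1} \<Longrightarrow> h (t, 0) = g1 0" "\<And>t. t \<in> {0..1} \<Longrightarrow> h (t, 1) = g1 1"
    using hom unfolding homotopic_paths by (auto simp: pathstart_def pathfinish_def)
  have "l1 0 \<in> C" "p (l1 0) = h (0, 0)"
    using l1 h0[of 0] by (auto simp: path_image_def)
  then obtain G where G: "continuous_on ({0..1} \<times> {0..1}) G" "G ` ({0..1} \<times> {0..1}) \<subseteq> C"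
    "\<And>z. z \<in> {0..1} \<times> {0..1} \<Longrightarrow> p (G z) = h z" "G (0, 0) = l1 0"
    using covering_space_lift_square[OF cov h(1)] h(2) by blast
  have Gc: "continuous_on {0..1} (\<lambda>t. G (f t))" if "continuous_on {0..1} f" "f ` {0..1} \<subseteq> {0..1} \<times> {0..1}" for f :: "real \<Rightarrow> real \<times> real"
    using that by (intro continuous_on_compose2[OF G(1)])
  have Gi: "G (s, t) \<in> C" if "s \<in> {0..1}" "t \<in> {0..1}" for s t
    using G(2) that by auto
  have l1c: "continuous_on {0..1} l1" "l1 ` {0..1} \<subseteq> C" and l2c: "continuous_on {0..1} l2" "l2 ` {0..1} \<subseteq> C"
    using l1 l2 by (auto simp: path_def path_image_def)
  have b: "G (s, 0) = l1 0" if "s \<in> {0..1}" for s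
    using G l1 that ends l1c(2)
    by (intro covering_space_unique_lift[OF cov, of "{0..1}" "\<lambda>s. G (s, 0)" "\<lambda>_. l1 0" 0 s] Gc)
      (auto intro!: continuous_intros Gi)
  have left: "G (0, t) = l1 t" if "t \<in> {0..1}" for t
    using G l1 that h0 l1c
    by (intro covering_space_unique_lift[OF cov, of "{0..1}" "\<lambda>s. G (0, s)" l1 0 t] Gc)
      (auto intro!: continuous_intros Gi)
  have right: "G (1, t) = l2 t" if "t \<in> {0..1}" for t
    using G l2 that h1 l2c start b[of 1]
    by (intro covering_space_unique_lift[OF cov, of "{0..1}" "\<lambda>s. G (1, s)" l2 0 t] Gc)
      (auto intro!: continuous_intros Gi simp: pathstart_def)
  have "G (s, 1) = G (0, 1)" if "s \<in> {0..1}" for s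
    using G that ends
    by (intro covering_space_unique_lift[OF cov, of "{0..1}" "\<lambda>s. G (s, 1)" "\<lambda>_. G (0, 1)" 0 s] Gc)
      (auto intro!: continuous_intros Gi)
  from this[of 1] left[of 1] right[of 1] show ?thesis
    by (simp add: pathfinish_def)
qed

lemma continuous_on_openin_cover:
  fixes f :: "'a::topological_space \<Rightarrow> 'b::topological_space"
  assumes "\<And>y. y \<in> Y \<Longrightarrow> \<exists>D. openin (top_of_set Y) D \<and> y \<in> D \<and> continuous_on D f"
  shows "continuous_on Y f"
  unfolding continuous_on_def
proof
  fix y assume y: "y \<in> Y"
  then obtain D where D: "openin (top_of_set Y) D" "y \<in> D" "continuous_on D f"
    using assms by blast
  then obtain U where U: "open U" "D = Y \<inter> U"
    by (auto simp: openin_open)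
  have "(f \<longlongrightarrow> f y) (at y within D)"
    using D by (simp add: continuous_on_def)
  moreover have "at y within D = at y within Y"
    using D U by (intro at_within_nhd[of y U]) auto
  ultimately show "(f \<longlongrightarrow> f y) (at y within Y)"
    by simp
qed

text \<open>Here \<open>p\<close> is lifted through itself. The value at \<open>u\<close> is found
  by lifting from \<open>y1\<close> the projection of a path from \<open>y0\<close> to
  \<open>u\<close>; any two such paths are homotopic in \<open>Y\<close>, so the value is well
  defined. Local path-connectedness gives continuity.\<close>

lemma covering_space_lift_self:
  fixes p :: "'b::topological_space \<Rightarrow> 'a::topological_space"
  assumes cov: "covering_space Y p X" and sc: "simply_connected Y" and lpc: "locally path_connected Y"
    and y: "y0 \<in> Y" "y1 \<in> Y" "p y0 = p y1"
  obtains f where "continuous_on Y f" "f ` Y \<subseteq> Y" "\<And>y. y \<in> Y \<Longrightarrow> p (f y) = p y" "f y0 = y1"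
proof -
  have pc: "continuous_on Y p" and pim: "p ` Y = X"
    using cov by (auto simp: covering_space_imp_continuous covering_space_imp_surjective)
  define R where "R u z \<longleftrightarrow> (\<exists>a b. path a \<and> path_image a \<subseteq> Y \<and> pathstart a = y0 \<and> pathfinish a = u \<and>
    path b \<and> path_image b \<subseteq> Y \<and> pathstart b = y1 \<and> pathfinish b = z \<and> (\<forall>t\<in>{0..1}. p (b t) = p (a t)))" for u z
  have total: "\<exists>z. R u z" if u: "u \<in> Y" for u
  proof -
    obtain a where a: "path a" "path_image a \<subseteq> Y" "pathstart a = y0" "pathfinish a = u"
      using simply_connected_path_connected[OF sc] y u unfolding path_connected_def by blast
    have pa: "path (p \<circ> a)" "path_image (p \<circ> a) \<subseteq> X" "p y1 = pathstart (p \<circ> a)"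
      using a pc pim y(3)
      by (auto intro!: path_continuous_image intro: continuous_on_subset simp: path_image_compose pathstart_compose)
    obtain b where b: "path b" "path_image b \<subseteq> Y" "pathstart b = y1" "\<And>t. t \<in> {0..1} \<Longrightarrow> p (b t) = (p \<circ> a) t"
      using covering_space_path_lift[OF cov pa(1,2) y(2) pa(3)] by metis
    have "R u (pathfinish b)"
      unfolding R_def using a b by (intro exI[of _ a] exI[of _ b]) auto
    then show ?thesis by blast
  qed
  have func: "z = z'" if R: "R u z" "R u z'" for u z z'
  proof -
    obtain a b where a: "path a" "path_image a \<subseteq> Y" "pathstart a = y0" "pathfinish a = u"
      and b: "path b" "path_image b \<subseteq> Y" "pathstart b = y1" "pathfinish b = z" "\<And>t. t \<in> {0..1} \<Longrightarrow> p (b t) = p (a t)"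
      using R(1) unfolding R_def by blast
    obtain a' b' where a': "path a'" "path_image a' \<subseteq> Y" "pathstart a' = y0" "pathfinish a' = u"
      and b': "path b'" "path_image b' \<subseteq> Y" "pathstart b' = y1" "pathfinish b' = z'" "\<And>t. t \<in> {0..1} \<Longrightarrow> p (b' t) = p (a' t)"
      using R(2) unfolding R_def by blast
    have "homotopic_paths Y a a'"
      using a a' by (intro simply_connected_homotopic_paths[OF sc]) auto
    then have "homotopic_paths X (p \<circ> a) (p \<circ> a')"
      using pc pim by (intro homotopic_paths_continuous_image) auto
    from covering_space_homotopic_lifts[OF cov this, of b b'] show ?thesis
      using b b' by auto
  qed
  define f where "f u = (SOME z. R u z)" for u
  have Rf: "R u (f u)" if "u \<in> Y" for u
    unfolding f_def using someI_ex[OF total[OF that]] .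
  have fR: "f u = z" if "R u z" "u \<in> Y" for u z
    using func[OF Rf[OF that(2)] that(1)] .
  have fY: "f u \<in> Y" if "u \<in> Y" for u
    using Rf[OF that] unfolding R_def by (metis pathfinish_in_path_image subsetD)
  have pf: "p (f u) = p u" if "u \<in> Y" for u
    using Rf[OF that] unfolding R_def pathfinish_def by (metis atLeastAtMost_iff order_refl zero_le_one)
  have "R y0 y1"
    unfolding R_def using y
    by (intro exI[of _ "\<lambda>_. y0"] exI[of _ "\<lambda>_. y1"]) (auto simp: path_def path_image_def)
  then have f0: "f y0 = y1"
    using fR y by blast
  have "continuous_on Y f"
  proof (rule continuous_on_openin_cover)
    fix u assume u: "u \<in> Y"
    obtain T W q where T: "f u \<in> T" "openin (top_of_set Y) T" and W: "p (f u) \<in> W" "openin (top_of_set X) W"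
      and q: "homeomorphism T W p q"
      using covering_space_local_homeomorphism[OF cov fY[OF u]] by metis
    have "openin (top_of_set Y) (Y \<inter> p -` W)"
      using pc pim W by (intro continuous_openin_preimage[where T = X]) auto
    moreover have "u \<in> Y \<inter> p -` W"
      using u W pf[OF u] by simp
    ultimately obtain D V where D: "openin (top_of_set Y) D" "u \<in> D" "D \<subseteq> V" "V \<subseteq> Y \<inter> p -` W" "path_connected V"
      using lpc unfolding locally_def by metis
    have TY: "T \<subseteq> Y" using T openin_imp_subset by blast
    \<comment> \<open>The local inverse \<open>q\<close> of \<open>p\<close> around
      \<open>f u\<close> suggests the candidate \<open>k\<close> for \<open>f\<close> near
      \<open>u\<close>. The two are compared by prolonging the paths that define \<open>f u\<close>:
      the lower one by \<open>d\<close>, its lift by \<open>k \<circ> d\<close>.\<close>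
    define k where "k = q \<circ> p"
    have kc: "continuous_on V k"
      unfolding k_def using D q pc
      by (intro continuous_on_compose) (auto simp: homeomorphism_def intro: continuous_on_subset)
    have kT: "k w \<in> T" "p (k w) = p w" if "w \<in> V" for w
      using subsetD[OF D(4) that] q by (auto simp: homeomorphism_def k_def)
    have ku: "k u = f u"
      using q T u pf[OF u] by (simp add: homeomorphism_def k_def flip: pf)
    have "f w = k w" if w: "w \<in> D" for w
    proof (rule fR)
      show wY: "w \<in> Y" using w D by blast
      obtain a b where a: "path a" "path_image a \<subseteq> Y" "pathstart a = y0" "pathfinish a = u"
        and b: "path b" "path_image b \<subseteq> Y" "pathstart b = y1" "pathfinish b = f u" "\<And>t. t \<in> {0..1} \<Longrightarrow> p (b t) = p (a t)"
        using Rf[OF u] unfolding R_def by blast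
      have uwV: "u \<in> V" "w \<in> V"
        using subsetD[OF D(3)] D(2) w by auto
      from D(5)[unfolded path_connected_def, rule_format, OF uwV]
      obtain d where d: "path d" "path_image d \<subseteq> V" "pathstart d = u" "pathfinish d = w"
        by metis
      have kd: "path (k \<circ> d)" "path_image (k \<circ> d) \<subseteq> Y" "pathstart (k \<circ> d) = f u" "pathfinish (k \<circ> d) = k w"
        using d kc kT TY ku
        by (auto intro!: path_continuous_image intro: continuous_on_subset simp: path_image_compose pathstart_compose pathfinish_compose)
      have dV: "d t \<in> V" if "t \<in> {0..1}" for t
        using d(2) that by (auto simp: path_image_def)
      show "R w (k w)"
        unfolding R_def
      proof (intro exI conjI ballI)
        show "path (a +++ d)" "path (b +++ (k \<circ> d))"
          using a b d kd by auto
        show "path_image (a +++ d) \<subseteq> Y" "path_image (b +++ (k \<circ> d)) \<subseteq> Y"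
          using D(4) by (intro subset_path_image_join a b kd order_trans[OF d(2)]; blast)+
        show "pathstart (a +++ d) = y0" "pathstart (b +++ (k \<circ> d)) = y1"
          "pathfinish (a +++ d) = w" "pathfinish (b +++ (k \<circ> d)) = k w"
          using a b d kd by auto
        show "p ((b +++ (k \<circ> d)) t) = p ((a +++ d) t)" if "t \<in> {0..1}" for t
          using that b(5)[of "2 * t"] kT(2)[OF dV, of "2 * t - 1"] by (auto simp: joinpaths_def)
      qed
    qed
    then have "continuous_on D f"
      using kc D by (metis continuous_on_cong continuous_on_subset)
    then show "\<exists>D. openin (top_of_set Y) D \<and> u \<in> D \<and> continuous_on D f"
      using D by blast
  qed
  then show ?thesis
    using that fY pf f0 by blast
qed

section \<open>The fundamental group and its action on the cover\<close>

definition homotopy_class :: "'a::topological_space set \<Rightarrow> (real \<Rightarrow> 'a) \<Rightarrow> (real \<Rightarrow> 'a) set" where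
  "homotopy_class X p = {q. homotopic_paths X p q}"

definition loops_at :: "'a::topological_space set \<Rightarrow> 'a \<Rightarrow> (real \<Rightarrow> 'a) set" where
  "loops_at X x = {p. path p \<and> path_image p \<subseteq> X \<and> pathstart p = x \<and> pathfinish p = x}"

lemma carrier_fundamental_group:
  "carrier (fundamental_group X x) = homotopy_class X ` loops_at X x"
  by (auto simp: fundamental_group_def homotopy_class_def loops_at_def)

lemma homotopy_class_eqI:
  assumes "homotopic_paths X p q"
  shows "homotopy_class X p = homotopy_class X q"
  using homotopic_paths_trans[OF assms] homotopic_paths_trans[OF homotopic_paths_sym[OF assms]]
  by (auto simp: homotopy_class_def)

lemma one_fundamental_group: "\<one>\<^bsub>fundamental_group X x\<^esub> = homotopy_class X (\<lambda>_. x)"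
  by (simp add: fundamental_group_def homotopy_class_def)

text \<open>The product in \<open>fundamental_group\<close> collects the concatenations of all
  representatives; compatibility of homotopy with joining reduces it to one pair.\<close>

lemma mult_fundamental_group:
  assumes "p \<in> loops_at X x" "q \<in> loops_at X x"
  shows "homotopy_class X p \<otimes>\<^bsub>fundamental_group X x\<^esub> homotopy_class X q = homotopy_class X (q +++ p)"
proof -
  have *: "homotopic_paths X (q +++ p) (q' +++ p')" if "homotopic_paths X p p'" "homotopic_paths X q q'" for p' q'
    using assms that by (intro homotopic_paths_join) (auto simp: loops_at_def)
  have "p \<in> homotopy_class X p" "q \<in> homotopy_class X q"
    using assms by (auto simp: homotopy_class_def loops_at_def)
  moreover have "homotopic_paths X (q +++ p) r"
    if "p' \<in> homotopy_class X p" "q' \<in> homotopy_class X q" "homotopic_paths X (q' +++ p') r" for p' q' r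
    using homotopic_paths_trans[OF *] that by (auto simp: homotopy_class_def)
  ultimately have "(\<exists>p'\<in>homotopy_class X p. \<exists>q'\<in>homotopy_class X q. homotopic_paths X (q' +++ p') r) \<longleftrightarrow>
      homotopic_paths X (q +++ p) r" for r
    by blast
  then show ?thesis
    by (simp add: fundamental_group_def flip: homotopy_class_def)
qed

lemma loops_at_join: "p \<in> loops_at X x \<Longrightarrow> q \<in> loops_at X x \<Longrightarrow> q +++ p \<in> loops_at X x"
  by (auto simp: loops_at_def subset_path_image_join)

lemma group_fundamental_group:
  assumes x: "x \<in> X"
  shows "group (fundamental_group X x)"
proof (rule groupI)
  have c: "(\<lambda>_. x) \<in> loops_at X x"
    using x by (auto simp: loops_at_def path_def path_image_def)
  then show "\<one>\<^bsub>fundamental_group X x\<^esub> \<in> carrier (fundamental_group X x)"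
    by (simp add: carrier_fundamental_group one_fundamental_group)
  show "\<gamma> \<otimes>\<^bsub>fundamental_group X x\<^esub> \<delta> \<in> carrier (fundamental_group X x)"
    if "\<gamma> \<in> carrier (fundamental_group X x)" "\<delta> \<in> carrier (fundamental_group X x)" for \<gamma> \<delta>
    using that by (auto simp: carrier_fundamental_group mult_fundamental_group loops_at_join)
  show "\<gamma> \<otimes>\<^bsub>fundamental_group X x\<^esub> \<delta> \<otimes>\<^bsub>fundamental_group X x\<^esub> \<epsilon> = \<gamma> \<otimes>\<^bsub>fundamental_group X x\<^esub> (\<delta> \<otimes>\<^bsub>fundamental_group X x\<^esub> \<epsilon>)"
    if "\<gamma> \<in> carrier (fundamental_group X x)" "\<delta> \<in> carrier (fundamental_group X x)" "\<epsilon> \<in> carrier (fundamental_group X x)" for \<gamma> \<delta> \<epsilon>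
  proof -
    from that obtain p q r where pqr: "p \<in> loops_at X x" "q \<in> loops_at X x" "r \<in> loops_at X x"
      "\<gamma> = homotopy_class X p" "\<delta> = homotopy_class X q" "\<epsilon> = homotopy_class X r"
      by (auto simp: carrier_fundamental_group)
    have "homotopic_paths X (r +++ (q +++ p)) ((r +++ q) +++ p)"
      using pqr by (intro homotopic_paths_assoc) (auto simp: loops_at_def)
    then show ?thesis
      using pqr by (simp add: mult_fundamental_group loops_at_join homotopy_class_eqI)
  qed
  show "\<one>\<^bsub>fundamental_group X x\<^esub> \<otimes>\<^bsub>fundamental_group X x\<^esub> \<gamma> = \<gamma>"
    if "\<gamma> \<in> carrier (fundamental_group X x)" for \<gamma>
  proof -
    from that obtain p where p: "p \<in> loops_at X x" "\<gamma> = homotopy_class X p"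
      by (auto simp: carrier_fundamental_group)
    then have "homotopic_paths X (p +++ (\<lambda>_. x)) p"
      by (intro homotopic_paths_join_const_right) (auto simp: loops_at_def)
    then show ?thesis
      using p c by (simp add: one_fundamental_group mult_fundamental_group homotopy_class_eqI)
  qed
  show "\<exists>\<delta>\<in>carrier (fundamental_group X x). \<delta> \<otimes>\<^bsub>fundamental_group X x\<^esub> \<gamma> = \<one>\<^bsub>fundamental_group X x\<^esub>"
    if "\<gamma> \<in> carrier (fundamental_group X x)" for \<gamma>
  proof -
    from that obtain p where p: "p \<in> loops_at X x" "\<gamma> = homotopy_class X p"
      by (auto simp: carrier_fundamental_group)
    then have "homotopic_paths X (p +++ reversepath p) (\<lambda>_. x)"
      using homotopic_paths_join_reversepath[of p X] by (auto simp: loops_at_def)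
    moreover have "reversepath p \<in> loops_at X x"
      using p by (auto simp: loops_at_def)
    ultimately show ?thesis
      using p by (intro bexI[of _ "homotopy_class X (reversepath p)"])
        (auto simp: one_fundamental_group mult_fundamental_group carrier_fundamental_group dest: homotopy_class_eqI)
  qed
qed

section \<open>Lifts of loops to a simply connected cover\<close>

locale based_cover =
  fixes X :: "'a::topological_space set" and Y :: "'b::topological_space set"
    and \<pi> :: "'b \<Rightarrow> 'a" and y0 :: 'b
  assumes cover: "covering_space Y \<pi> X"
    and simply_conn: "simply_connected Y"
    and loc_path_conn: "locally path_connected Y"
    and base: "y0 \<in> Y"
begin

abbreviation "\<Gamma> \<equiv> fundamental_group X (\<pi> y0)"

text \<open>This is the premise on \<open>l\<close> inside \<open>deck_action\<close>, given a name
  so that the definite description there can be analysed.\<close>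

definition lift_of :: "(real \<Rightarrow> 'a) set \<Rightarrow> (real \<Rightarrow> 'b) \<Rightarrow> bool" where
  "lift_of \<gamma> l \<longleftrightarrow> path l \<and> path_image l \<subseteq> Y \<and> pathstart l = y0 \<and> \<pi> \<circ> l \<in> \<gamma>"

lemma proj: "continuous_on Y \<pi>" "\<pi> ` Y = X"
  using cover by (auto simp: covering_space_imp_continuous covering_space_imp_surjective)

lemma base_in_X: "\<pi> y0 \<in> X"
  using proj base by blast

lemma path_conn: "path_connected Y"
  using simply_conn by (rule simply_connected_path_connected)

lemma proj_path:
  assumes "path l" "path_image l \<subseteq> Y"
  shows "path (\<pi> \<circ> l)" "path_image (\<pi> \<circ> l) \<subseteq> X"
  using assms proj by (auto intro!: path_continuous_image intro: continuous_on_subset simp: path_image_compose)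

lemma proj_homotopic:
  assumes "path l" "path_image l \<subseteq> Y" "path l'" "path_image l' \<subseteq> Y"
    "pathstart l' = pathstart l" "pathfinish l' = pathfinish l"
  shows "homotopic_paths X (\<pi> \<circ> l) (\<pi> \<circ> l')"
  using simply_connected_homotopic_paths[OF simply_conn assms(1-4)] assms(5,6) proj
  by (intro homotopic_paths_continuous_image) auto

lemma homotopic_in_class:
  assumes "\<gamma> \<in> carrier \<Gamma>" "p \<in> \<gamma>"
  shows "q \<in> \<gamma> \<longleftrightarrow> homotopic_paths X p q" "p \<in> loops_at X (\<pi> y0)"
proof -
  obtain r where r: "r \<in> loops_at X (\<pi> y0)" "\<gamma> = homotopy_class X r"
    using assms(1) by (auto simp: carrier_fundamental_group)
  then have rp: "homotopic_paths X r p"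
    using assms(2) by (simp add: homotopy_class_def)
  then show "q \<in> \<gamma> \<longleftrightarrow> homotopic_paths X p q"
    using r homotopy_class_eqI[OF rp] by (simp add: homotopy_class_def)
  show "p \<in> loops_at X (\<pi> y0)"
    using r(1) homotopic_paths_imp_path[OF rp] homotopic_paths_imp_subset[OF rp]
      homotopic_paths_imp_pathstart[OF rp] homotopic_paths_imp_pathfinish[OF rp]
    by (simp add: loops_at_def)
qed

lemma lift_exists:
  assumes \<gamma>: "\<gamma> \<in> carrier \<Gamma>" "p \<in> \<gamma>"
  obtains l where "lift_of \<gamma> l" "\<And>t. t \<in> {0..1} \<Longrightarrow> \<pi> (l t) = p t"
proof -
  have p: "p \<in> loops_at X (\<pi> y0)"
    using homotopic_in_class[OF \<gamma>] by blast
  then obtain l where l: "path l" "path_image l \<subseteq> Y" "pathstart l = y0" "\<And>t. t \<in> {0..1} \<Longrightarrow> \<pi> (l t) = p t"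
    using covering_space_path_lift[OF cover, of p y0] base by (auto simp: loops_at_def)
  \<comment> \<open>\<open>\<pi> \<circ> l\<close> and \<open>p\<close> agree only on the unit
    interval, so they are homotopic but may differ as functions.\<close>
  have "homotopic_paths X p (\<pi> \<circ> l)"
    using p l by (intro homotopic_paths_eq) (auto simp: loops_at_def)
  then show ?thesis
    using that[of l] l homotopic_in_class(1)[OF \<gamma>] by (simp add: lift_of_def)
qed

lemma class_nonempty:
  assumes "\<gamma> \<in> carrier \<Gamma>"
  shows "\<exists>p. p \<in> \<gamma>"
proof -
  obtain p where "p \<in> loops_at X (\<pi> y0)" "\<gamma> = homotopy_class X p"
    using assms by (auto simp: carrier_fundamental_group)
  then have "p \<in> \<gamma>"
    by (auto simp: homotopy_class_def loops_at_def)
  then show ?thesis by blast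
qed

lemma lift_finish_unique:
  assumes "\<gamma> \<in> carrier \<Gamma>" "lift_of \<gamma> l" "lift_of \<gamma> l'"
  shows "pathfinish l = pathfinish l'"
proof -
  have "homotopic_paths X (\<pi> \<circ> l) (\<pi> \<circ> l')"
    using assms homotopic_in_class(1)[OF assms(1)] by (auto simp: lift_of_def)
  from covering_space_homotopic_lifts[OF cover this, of l l'] show ?thesis
    using assms by (auto simp: lift_of_def)
qed

lemma lift_finish:
  assumes "\<gamma> \<in> carrier \<Gamma>" "lift_of \<gamma> l"
  shows "pathfinish l \<in> Y" "\<pi> (pathfinish l) = \<pi> y0"
  using assms homotopic_in_class(2)[OF assms(1), of "\<pi> \<circ> l"]
  by (auto simp: lift_of_def loops_at_def pathfinish_compose)

text \<open>In a simply connected cover only the end points of a path matter up to homotopy. This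
  allows an arbitrary lift to be exchanged for one with piecewise C1 projection.\<close>

lemma lift_of_homotopic:
  assumes "\<gamma> \<in> carrier \<Gamma>" "lift_of \<gamma> l" "path l'" "path_image l' \<subseteq> Y" "pathstart l' = y0" "pathfinish l' = pathfinish l"
  shows "lift_of \<gamma> l'"
  using assms proj_homotopic[of l l'] homotopic_in_class(1)[OF assms(1), of "\<pi> \<circ> l"]
  by (auto simp: lift_of_def)

section \<open>Deck transformations\<close>

lemma deckD:
  assumes "f \<in> deck_transformations Y \<pi>"
  shows "continuous_on Y f" "f ` Y = Y" "\<And>y. y \<in> Y \<Longrightarrow> f y \<in> Y" "\<And>y. y \<in> Y \<Longrightarrow> \<pi> (f y) = \<pi> y"
  using assms by (auto simp: deck_transformations_def homeomorphism_def)

lemma deck_inverse: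
  assumes "f \<in> deck_transformations Y \<pi>"
  obtains g where "homeomorphism Y Y f g" "\<And>y. y \<in> Y \<Longrightarrow> \<pi> (g y) = \<pi> y"
proof -
  obtain g where g: "homeomorphism Y Y f g"
    using assms by (auto simp: deck_transformations_def)
  have "\<pi> (g y) = \<pi> y" if "y \<in> Y" for y
  proof -
    have "g y \<in> Y" "f (g y) = y"
      using g that by (auto simp: homeomorphism_def)
    then show ?thesis
      using deckD(4)[OF assms, of "g y"] by simp
  qed
  then show ?thesis using that g by blast
qed

lemma self_lift_unique:
  assumes "continuous_on Y f" "\<And>y. y \<in> Y \<Longrightarrow> f y \<in> Y" "\<And>y. y \<in> Y \<Longrightarrow> \<pi> (f y) = \<pi> y"
    and "continuous_on Y g" "\<And>y. y \<in> Y \<Longrightarrow> g y \<in> Y" "\<And>y. y \<in> Y \<Longrightarrow> \<pi> (g y) = \<pi> y"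
    and "z \<in> Y" "f z = g z" "y \<in> Y"
  shows "f y = g y"
  by (rule covering_space_unique_lift[OF cover path_connected_imp_connected[OF path_conn], of f g z y])
    (use assms in \<open>simp_all add: image_subset_iff\<close>)

lemma deck_unique:
  assumes f: "f \<in> deck_transformations Y \<pi>" and g: "g \<in> deck_transformations Y \<pi>" and z: "z \<in> Y" "f z = g z"
  shows "f = g"
proof (rule extensionalityI)
  show "f \<in> extensional Y" "g \<in> extensional Y"
    using assms by (auto simp: deck_transformations_def)
  show "f y = g y" if "y \<in> Y" for y
    by (rule self_lift_unique[OF deckD(1,3,4)[OF f] deckD(1,3,4)[OF g] z that])
qed

text \<open>Lift \<pi> through itself once with \<open>y\<close> sent to \<open>y'\<close> and once
  with \<open>y'\<close> sent to \<open>y\<close>; each composite fixes a point and is therefore the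
  identity.\<close>

lemma deck_exists:
  assumes "y \<in> Y" "y' \<in> Y" "\<pi> y = \<pi> y'"
  obtains f where "f \<in> deck_transformations Y \<pi>" "f y = y'"
proof -
  obtain f where f: "continuous_on Y f" "f ` Y \<subseteq> Y" "\<And>y. y \<in> Y \<Longrightarrow> \<pi> (f y) = \<pi> y" "f y = y'"
    using covering_space_lift_self[OF cover simply_conn loc_path_conn assms] by metis
  obtain g where g: "continuous_on Y g" "g ` Y \<subseteq> Y" "\<And>y. y \<in> Y \<Longrightarrow> \<pi> (g y) = \<pi> y" "g y' = y"
    using covering_space_lift_self[OF cover simply_conn loc_path_conn assms(2,1)] assms(3) by metis
  have f_in: "f z \<in> Y" and g_in: "g z \<in> Y" if "z \<in> Y" for z
    using f(2) g(2) that by auto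
  have gf: "g (f z) = z" if "z \<in> Y" for z
    by (rule self_lift_unique[of "\<lambda>z. g (f z)" "\<lambda>z. z" y z])
      (use f g f_in g_in assms(1) that in \<open>simp_all add: continuous_on_compose2[OF g(1) f(1,2)] continuous_on_id\<close>)
  have fg: "f (g z) = z" if "z \<in> Y" for z
    by (rule self_lift_unique[of "\<lambda>z. f (g z)" "\<lambda>z. z" y' z])
      (use f g f_in g_in assms(2) that in \<open>simp_all add: continuous_on_compose2[OF f(1) g(1,2)] continuous_on_id\<close>)
  have "Y \<subseteq> f ` Y" "Y \<subseteq> g ` Y"
    using f(2) g(2) fg gf by (metis image_eqI image_subset_iff subsetI)+
  \<comment> \<open>Members of \<open>deck_transformations\<close> are extensional, hence the
    restriction.\<close>
  then have "homeomorphism Y Y (restrict f Y) g"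
    unfolding homeomorphism_def using f g gf fg by (auto cong: continuous_on_cong)
  then have "restrict f Y \<in> deck_transformations Y \<pi>"
    using f by (auto simp: deck_transformations_def)
  then show ?thesis
    using that[of "restrict f Y"] f assms by auto
qed

section \<open>The action of the fundamental group on the cover\<close>

abbreviation "act \<equiv> deck_action Y \<pi> y0"

text \<open>Exactly one map meets the definite description: all lifts of \<gamma> end at the same
  point of the base fibre, some deck transformation takes that point to \<open>y0\<close>, and one
  value determines a deck transformation. Since a lift exists, the implication in the description is
  not vacuous.\<close>

lemma act_deck_lift:
  assumes \<gamma>: "\<gamma> \<in> carrier \<Gamma>"
  shows "act \<gamma> \<in> deck_transformations Y \<pi> \<and> (\<forall>l. lift_of \<gamma> l \<longrightarrow> act \<gamma> (pathfinish l) = y0)"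
proof -
  obtain l where l: "lift_of \<gamma> l"
    using lift_exists class_nonempty \<gamma> by metis
  obtain f where f: "f \<in> deck_transformations Y \<pi>" "f (pathfinish l) = y0"
    using deck_exists lift_finish[OF \<gamma> l] base by metis
  have eq: "act \<gamma> = (THE f. f \<in> deck_transformations Y \<pi> \<and> (\<forall>l. lift_of \<gamma> l \<longrightarrow> f (pathfinish l) = y0))"
    unfolding deck_action_def lift_of_def ..
  show ?thesis
    unfolding eq
  proof (rule theI[of _ f])
    show "f \<in> deck_transformations Y \<pi> \<and> (\<forall>l. lift_of \<gamma> l \<longrightarrow> f (pathfinish l) = y0)"
      using f lift_finish_unique[OF \<gamma> _ l] by metis
    show "g = f" if "g \<in> deck_transformations Y \<pi> \<and> (\<forall>l. lift_of \<gamma> l \<longrightarrow> g (pathfinish l) = y0)" for g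
      using that f l lift_finish[OF \<gamma> l] by (intro deck_unique) auto
  qed
qed

lemma act_deck: "\<gamma> \<in> carrier \<Gamma> \<Longrightarrow> act \<gamma> \<in> deck_transformations Y \<pi>"
  using act_deck_lift by blast

lemma act_lift_finish: "\<gamma> \<in> carrier \<Gamma> \<Longrightarrow> lift_of \<gamma> l \<Longrightarrow> act \<gamma> (pathfinish l) = y0"
  using act_deck_lift by blast

text \<open>The loop \<delta> comes first in the product, so the product lifts to \<open>m\<close>
  followed by the translate of \<open>l\<close> that starts at the end of \<open>m\<close>. The
  translating map is \<open>g\<close>, the inverse of \<open>act \<delta>\<close>; hence
  \<open>act \<delta>\<close> takes the end of \<open>n\<close> to the end of \<open>l\<close>, and
  \<open>act \<gamma>\<close> takes that to \<open>y0\<close>.\<close>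

lemma act_mult:
  assumes \<gamma>: "\<gamma> \<in> carrier \<Gamma>" and \<delta>: "\<delta> \<in> carrier \<Gamma>" and y: "y \<in> Y"
  shows "act (\<gamma> \<otimes>\<^bsub>\<Gamma>\<^esub> \<delta>) y = act \<gamma> (act \<delta> y)"
proof -
  obtain l where l: "lift_of \<gamma> l"
    using lift_exists class_nonempty \<gamma> by metis
  obtain m where m: "lift_of \<delta> m"
    using lift_exists class_nonempty \<delta> by metis
  obtain g where g: "homeomorphism Y Y (act \<delta>) g" "\<And>y. y \<in> Y \<Longrightarrow> \<pi> (g y) = \<pi> y"
    using deck_inverse[OF act_deck[OF \<delta>]] by metis
  have gc: "continuous_on Y g" "g ` Y = Y" "\<And>y. y \<in> Y \<Longrightarrow> g (act \<delta> y) = y" "\<And>y. y \<in> Y \<Longrightarrow> act \<delta> (g y) = y"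
    using g(1) by (auto simp: homeomorphism_def)
  have g0: "g y0 = pathfinish m"
    using gc(3)[OF lift_finish(1)[OF \<delta> m]] act_lift_finish[OF \<delta> m] by simp
  define n where "n = m +++ (g \<circ> l)"
  have l': "path l" "path_image l \<subseteq> Y" "pathstart l = y0"
    using l by (auto simp: lift_of_def)
  have gl: "path (g \<circ> l)" "path_image (g \<circ> l) \<subseteq> Y" "pathstart (g \<circ> l) = pathfinish m" "pathfinish (g \<circ> l) = g (pathfinish l)"
    using l' g0 image_mono[OF l'(2), of g] gc(2)
    by (simp_all add: path_image_compose pathstart_compose pathfinish_compose
       path_continuous_image continuous_on_subset[OF gc(1)])
  have lY: "l t \<in> Y" if "t \<in> {0..1}" for t
    using l that by (auto simp: lift_of_def path_image_def)
  have \<gamma>\<delta>: "\<gamma> \<otimes>\<^bsub>\<Gamma>\<^esub> \<delta> \<in> carrier \<Gamma>"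
    using group.is_monoid[OF group_fundamental_group[OF base_in_X]] \<gamma> \<delta> by (simp add: monoid.m_closed)
  have n: "path n" "path_image n \<subseteq> Y" "pathstart n = y0" "pathfinish n = g (pathfinish l)"
    using m gl by (auto simp: n_def lift_of_def subset_path_image_join)
  have "homotopic_paths X ((\<pi> \<circ> m) +++ (\<pi> \<circ> l)) (\<pi> \<circ> n)"
  proof (rule homotopic_paths_sym, rule homotopic_paths_eq)
    show "(\<pi> \<circ> n) t = ((\<pi> \<circ> m) +++ (\<pi> \<circ> l)) t" if "t \<in> {0..1}" for t
      using that g(2)[OF lY, of "2 * t - 1"] by (auto simp: n_def joinpaths_def)
  qed (use proj_path n in auto)
  then have "lift_of (\<gamma> \<otimes>\<^bsub>\<Gamma>\<^esub> \<delta>) n"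
    using l m n unfolding lift_of_def fundamental_group_def by auto
  then have "act (\<gamma> \<otimes>\<^bsub>\<Gamma>\<^esub> \<delta>) (pathfinish n) = y0"
    by (rule act_lift_finish[OF \<gamma>\<delta>])
  moreover have "act \<gamma> (act \<delta> (pathfinish n)) = y0"
    using gc(4)[OF lift_finish(1)[OF \<gamma> l]] act_lift_finish[OF \<gamma> l] n(4) by simp
  moreover have "pathfinish n \<in> Y"
    using n by (metis pathfinish_in_path_image subsetD)
  ultimately show ?thesis
    by (intro self_lift_unique[of "act (\<gamma> \<otimes>\<^bsub>\<Gamma>\<^esub> \<delta>)" "\<lambda>y. act \<gamma> (act \<delta> y)" "pathfinish n" y]
        continuous_on_compose2[OF deckD(1)[OF act_deck[OF \<gamma>]] deckD(1)[OF act_deck[OF \<delta>]]])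
      (simp_all add: y deckD[OF act_deck[OF \<gamma>]] deckD[OF act_deck[OF \<delta>]] deckD[OF act_deck[OF \<gamma>\<delta>]])
qed

lemma act_one:
  assumes y: "y \<in> Y"
  shows "act \<one>\<^bsub>\<Gamma>\<^esub> y = y"
proof -
  have one: "\<one>\<^bsub>\<Gamma>\<^esub> \<in> carrier \<Gamma>"
    using group.is_monoid[OF group_fundamental_group[OF base_in_X]] by (simp add: monoid.one_closed)
  have "homotopic_paths X (\<lambda>_. \<pi> y0) (\<pi> \<circ> (\<lambda>_. y0))"
    using base_in_X by (intro homotopic_paths_eq) (auto simp: path_def path_image_def)
  then have "lift_of \<one>\<^bsub>\<Gamma>\<^esub> (\<lambda>_. y0)"
    using base by (auto simp: lift_of_def one_fundamental_group homotopy_class_def path_def path_image_def)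
  from act_lift_finish[OF one this] have "act \<one>\<^bsub>\<Gamma>\<^esub> y0 = y0"
    by simp
  then show ?thesis
    by (intro self_lift_unique[of "act \<one>\<^bsub>\<Gamma>\<^esub>" "\<lambda>y. y" y0 y])
      (simp_all add: base y deckD[OF act_deck[OF one]] continuous_on_id)
qed

text \<open>Take a deck transformation \<open>f\<close> from \<open>y\<close> to \<open>y'\<close>
  and let \<open>e\<close> be the point that \<open>f\<close> sends to \<open>y0\<close>. A path
  from \<open>y0\<close> to \<open>e\<close> projects to a loop whose class acts as
  \<open>f\<close>, because both send \<open>e\<close> to \<open>y0\<close>.\<close>

lemma act_transitive:
  assumes y: "y \<in> Y" "y' \<in> Y" "\<pi> y = \<pi> y'"
  obtains \<gamma> where "\<gamma> \<in> carrier \<Gamma>" "act \<gamma> y = y'"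
proof -
  obtain f where f: "f \<in> deck_transformations Y \<pi>" "f y = y'"
    using deck_exists y by metis
  obtain e where e: "e \<in> Y" "f e = y0"
    using deckD(2)[OF f(1)] base by (metis imageE)
  obtain l where l: "path l" "path_image l \<subseteq> Y" "pathstart l = y0" "pathfinish l = e"
    using path_conn base e unfolding path_connected_def by blast
  have "\<pi> e = \<pi> y0"
    using deckD(4)[OF f(1) e(1)] e(2) by simp
  then have "\<pi> \<circ> l \<in> loops_at X (\<pi> y0)"
    using proj_path l by (auto simp: loops_at_def pathstart_compose pathfinish_compose)
  then have \<gamma>: "homotopy_class X (\<pi> \<circ> l) \<in> carrier \<Gamma>" and "\<pi> \<circ> l \<in> homotopy_class X (\<pi> \<circ> l)"
    by (auto simp: carrier_fundamental_group homotopy_class_def loops_at_def)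
  then have "act (homotopy_class X (\<pi> \<circ> l)) e = y0"
    using act_lift_finish[OF \<gamma>, of l] l by (auto simp: lift_of_def)
  then have "act (homotopy_class X (\<pi> \<circ> l)) = f"
    using e by (intro deck_unique[OF act_deck[OF \<gamma>] f(1)]) auto
  then show ?thesis
    using that \<gamma> f by metis
qed

end

section \<open>Smooth functions, charts and piecewise smooth paths\<close>

lemma smooth_on_differentiable:
  assumes "smooth_on S f" "x \<in> S"
  shows "f differentiable (at x)"
  using assms(1)[unfolded smooth_on_def, rule_format, of "Suc 0"] assms(2) by simp

lemma smooth_on_continuous:
  assumes "smooth_on S f"
  shows "continuous_on S f"
  using assms[unfolded smooth_on_def, rule_format, of 0] by simp

lemma smooth_on_continuous_frechet_derivative:
  assumes "smooth_on S f"
  shows "continuous_on S (\<lambda>x. frechet_derivative f (at x) v)"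
  using assms[unfolded smooth_on_def, rule_format, of "Suc 0"] by simp

lemma higher_differentiable_on_cong:
  assumes "open S" "\<And>x. x \<in> S \<Longrightarrow> f x = g x" "higher_differentiable_on S f k"
  shows "higher_differentiable_on S g k"
  using assms(2,3)
proof (induction k arbitrary: f g)
  case 0
  then show ?case by (simp cong: continuous_on_cong)
next
  case (Suc k)
  have eq: "frechet_derivative f (at x) = frechet_derivative g (at x)" if "x \<in> S" for x
    using Suc.prems that assms(1) by (intro frechet_derivative_transform_within_open[of f x S g]) auto
  have "g differentiable (at x)" if x: "x \<in> S" for x
  proof -
    have "(f has_derivative frechet_derivative f (at x)) (at x)"
      using Suc.prems x by (simp add: frechet_derivative_works)
    then have "(g has_derivative frechet_derivative f (at x)) (at x)"
      by (rule has_derivative_transform_within_open[OF _ assms(1) x]) (rule Suc.prems(1))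
    then show ?thesis
      by (auto simp: differentiable_def)
  qed
  moreover have "higher_differentiable_on S (\<lambda>x. frechet_derivative g (at x) v) k" for v
  proof (rule Suc.IH[of "\<lambda>x. frechet_derivative f (at x) v"])
    show "higher_differentiable_on S (\<lambda>x. frechet_derivative f (at x) v) k"
      using Suc.prems(2) by simp
  qed (simp add: eq)
  ultimately show ?case by simp
qed

lemma smooth_on_const: "smooth_on S (\<lambda>_. c)"
proof -
  have "higher_differentiable_on S (\<lambda>_. c) k" for k
    by (induction k arbitrary: c) simp_all
  then show ?thesis
    by (simp add: smooth_on_def)
qed

lemma smooth_on_add_scaleR:
  assumes S: "open S" and f: "smooth_on S f" and g: "smooth_on S g"
  shows "smooth_on S (\<lambda>x. f x + c *\<^sub>R g x)"
proof -
  have *: "higher_differentiable_on S (\<lambda>x. f x + c *\<^sub>R g x) k"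
    if "higher_differentiable_on S f k" "higher_differentiable_on S g k" for k f g
    using that
  proof (induction k arbitrary: f g)
    case 0
    then show ?case by (auto intro!: continuous_intros)
  next
    case (Suc k)
    have der: "((\<lambda>x. f x + c *\<^sub>R g x) has_derivative
        (\<lambda>v. frechet_derivative f (at x) v + c *\<^sub>R frechet_derivative g (at x) v)) (at x)" if "x \<in> S" for x
      using Suc.prems that by (auto intro!: derivative_eq_intros simp: frechet_derivative_works)
    have "higher_differentiable_on S (\<lambda>x. frechet_derivative (\<lambda>x. f x + c *\<^sub>R g x) (at x) v) k" for v
    proof (rule higher_differentiable_on_cong[OF S])
      show "higher_differentiable_on S (\<lambda>x. frechet_derivative f (at x) v + c *\<^sub>R frechet_derivative g (at x) v) k"
        using Suc by auto
    qed (simp add: frechet_derivative_at[OF der, symmetric])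
    then show ?case
      using der by (auto simp: differentiable_def)
  qed
  then show ?thesis
    using f g unfolding smooth_on_def by (intro allI *) simp_all
qed

text \<open>The manifold condition provides some inverse of the coordinate map; since that map is
  injective on the domain, the inverse agrees with \<open>chart_inv\<close> on the image.\<close>

lemma
  assumes "smooth_manifold X A" "c \<in> A"
  shows chart_domain_openin: "openin (top_of_set X) (fst c)"
    and chart_image_open: "open (snd c ` fst c)"
    and chart_homeomorphism: "homeomorphism (fst c) (snd c ` fst c) (snd c) (chart_inv c)"
proof -
  obtain U \<phi> where c: "c = (U, \<phi>)" by force
  have "openin (top_of_set X) U \<and> open (\<phi> ` U) \<and> (\<exists>\<psi>. homeomorphism U (\<phi> ` U) \<phi> \<psi>)"
    using assms unfolding smooth_manifold_def c by auto
  then obtain \<psi> where h: "openin (top_of_set X) U" "open (\<phi> ` U)" "homeomorphism U (\<phi> ` U) \<phi> \<psi>"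
    by auto
  then show "openin (top_of_set X) (fst c)" "open (snd c ` fst c)"
    by (auto simp: c)
  have "inj_on \<phi> U"
    using h(3) by (metis homeomorphism_apply1 inj_on_inverseI)
  then have "chart_inv c (\<phi> u) = u" if "u \<in> U" for u
    using that by (simp add: chart_inv_def c)
  moreover have "\<psi> (\<phi> u) = u" if "u \<in> U" for u
    using h(3) that by (simp add: homeomorphism_def)
  ultimately have "homeomorphism U (\<phi> ` U) \<phi> (chart_inv c)"
    using h(3) by (intro homeomorphism_cong[OF h(3)]) auto
  then show "homeomorphism (fst c) (snd c ` fst c) (snd c) (chart_inv c)"
    by (simp add: c)
qed

lemma smooth_transition:
  assumes "smooth_manifold X A" "c \<in> A" "c' \<in> A"
  shows "smooth_on (snd c ` (fst c \<inter> fst c')) (snd c' \<circ> chart_inv c)"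
proof -
  have "\<forall>(U, \<phi>)\<in>A. \<forall>(V, \<psi>)\<in>A. smooth_on (\<phi> ` (U \<inter> V)) (\<psi> \<circ> chart_inv (U, \<phi>))"
    using assms(1) by (simp add: smooth_manifold_def)
  from bspec[OF this assms(2)] have "\<forall>(V, \<psi>)\<in>A. smooth_on (snd c ` (fst c \<inter> V)) (\<psi> \<circ> chart_inv c)"
    by (simp add: case_prod_beta)
  from bspec[OF this assms(3)] show ?thesis
    by (simp add: case_prod_beta)
qed

lemma chart_image_openin:
  assumes "smooth_manifold X A" "c \<in> A" "openin (top_of_set X) V" "V \<subseteq> fst c"
  shows "open (snd c ` V)"
proof -
  have "openin (top_of_set (fst c)) V"
    using assms(3,4) openin_imp_subset[OF chart_domain_openin[OF assms(1,2)]] by (rule openin_subset_trans)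
  then have "openin (top_of_set (snd c ` fst c)) (snd c ` V)"
    using chart_homeomorphism[OF assms(1,2)] homeomorphism_imp_open_map by blast
  then show ?thesis
    using chart_image_open[OF assms(1,2)] openin_open_trans by blast
qed

lemma chart_inv_apply:
  assumes "smooth_manifold X A" "c \<in> A" "p \<in> fst c"
  shows "chart_inv c (snd c p) = p"
  using chart_homeomorphism[OF assms(1,2)] assms(3) by (simp add: homeomorphism_def)

lemma chart_at_mem:
  assumes "smooth_manifold X A" "p \<in> X"
  shows "chart_at A p \<in> A" "p \<in> fst (chart_at A p)"
proof -
  have "\<exists>c. c \<in> A \<and> p \<in> fst c"
    using assms unfolding smooth_manifold_def by auto
  from someI_ex[OF this] show "chart_at A p \<in> A" "p \<in> fst (chart_at A p)"
    by (simp_all add: chart_at_def)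
qed

lemma smooth_fun_chart: "smooth_fun A f \<Longrightarrow> c \<in> A \<Longrightarrow> smooth_on (snd c ` fst c) (f \<circ> chart_inv c)"
  unfolding smooth_fun_def by (auto simp: case_prod_beta)

lemma smooth_fun_continuous:
  assumes m: "smooth_manifold X A" and f: "smooth_fun A f"
  shows "continuous_on X f"
proof (rule continuous_on_openin_cover)
  fix p assume p: "p \<in> X"
  let ?c = "chart_at A p"
  note c = chart_at_mem[OF m p]
  have "continuous_on (fst ?c) ((f \<circ> chart_inv ?c) \<circ> snd ?c)"
    by (rule continuous_on_compose[OF homeomorphism_cont1[OF chart_homeomorphism[OF m c(1)]]
          smooth_on_continuous[OF smooth_fun_chart[OF f c(1)]]])
  then have "continuous_on (fst ?c) f"
    by (rule continuous_on_eq) (simp add: chart_inv_apply[OF m c(1)])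
  then show "\<exists>D. openin (top_of_set X) D \<and> p \<in> D \<and> continuous_on D f"
    using chart_domain_openin[OF m c(1)] c(2) by blast
qed

text \<open>Derivatives are two-sided in the real line while \<open>S\<close> may be any set, so
  agreement of \<open>g\<close> with the reparametrised \<open>f\<close> is asked for on an open
  \<open>Q\<close> around \<open>S\<close>. The two halves of a joined path are the instances in
  view.\<close>

lemma C1_differentiable_on_affine:
  fixes f g :: "real \<Rightarrow> 'e::real_normed_vector"
  assumes f: "f C1_differentiable_on T" and O: "open Q" "S \<subseteq> Q" "\<And>t. t \<in> Q \<Longrightarrow> g t = f (m * t + b)"
    and ST: "\<And>t. t \<in> S \<Longrightarrow> m * t + b \<in> T"
  shows "g C1_differentiable_on S"
proof -
  obtain D where D: "\<And>t. t \<in> T \<Longrightarrow> (f has_vector_derivative D t) (at t)" "continuous_on T D"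
    using f unfolding C1_differentiable_on_def by blast
  have "(g has_vector_derivative m *\<^sub>R D (m * t + b)) (at t)" if t: "t \<in> S" for t
  proof -
    have "((\<lambda>t. m * t + b) has_vector_derivative m) (at t)"
      by (auto intro!: derivative_eq_intros simp: has_real_derivative_iff_has_vector_derivative[symmetric])
    from vector_diff_chain_at[OF this D(1)[OF ST[OF t]]]
    have "((\<lambda>t. f (m * t + b)) has_vector_derivative m *\<^sub>R D (m * t + b)) (at t)"
      by (simp add: o_def)
    then show ?thesis
      by (rule has_vector_derivative_transform_within_open[OF _ O(1) subsetD[OF O(2) t]])
        (rule O(3)[symmetric])
  qed
  moreover have "continuous_on S (\<lambda>t. m *\<^sub>R D (m * t + b))"
    by (intro continuous_intros continuous_on_compose2[OF D(2)]) (use ST in auto)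
  ultimately show ?thesis
    unfolding C1_differentiable_on_def by (intro exI[of _ "\<lambda>t. m *\<^sub>R D (m * t + b)"] conjI ballI)
qed

lemma C1_differentiable_on_split:
  fixes f :: "real \<Rightarrow> 'e::real_normed_vector"
  assumes "f C1_differentiable_on (S \<inter> {..<a})" "f C1_differentiable_on (S \<inter> {a<..})" "a \<notin> S"
  shows "f C1_differentiable_on S"
proof -
  let ?D = "\<lambda>t. vector_derivative f (at t)"
  have "t < a \<or> t > a" if "t \<in> S" for t
    using assms(3) that by (cases t a rule: linorder_cases) auto
  then have S: "S = (S \<inter> {..<a}) \<union> (S \<inter> {a<..})"
    by auto
  have "continuous_on S ?D"
  proof (rule continuous_on_openin_cover)
    fix t assume "t \<in> S"
    then have "t \<in> S \<inter> {..<a} \<or> t \<in> S \<inter> {a<..}"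
      using S by blast
    moreover have "continuous_on (S \<inter> {..<a}) ?D" "continuous_on (S \<inter> {a<..}) ?D"
      using assms by (auto simp: C1_differentiable_on_eq)
    ultimately show "\<exists>D. openin (top_of_set S) D \<and> t \<in> D \<and> continuous_on D ?D"
      by (metis openin_open_Int open_lessThan open_greaterThan)
  qed
  moreover have "f differentiable (at t)" if "t \<in> S" for t
  proof -
    have "t \<in> S \<inter> {..<a} \<or> t \<in> S \<inter> {a<..}"
      using S that by blast
    then show ?thesis
      using assms(1,2) by (auto simp: C1_differentiable_on_eq)
  qed
  ultimately show ?thesis
    by (simp add: C1_differentiable_on_eq)
qed

lemma piecewise_C1_path_join:
  assumes g1: "piecewise_C1_path X A g1" and g2: "piecewise_C1_path X A g2" and e: "pathfinish g1 = pathstart g2"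
  shows "piecewise_C1_path X A (g1 +++ g2)"
proof -
  obtain K1 where K1: "finite K1" "\<And>c. c \<in> A \<Longrightarrow> (snd c \<circ> g1) C1_differentiable_on {t \<in> {0..1} - K1. g1 t \<in> fst c}"
    using g1 unfolding piecewise_C1_path_def by (auto simp: case_prod_beta)
  obtain K2 where K2: "finite K2" "\<And>c. c \<in> A \<Longrightarrow> (snd c \<circ> g2) C1_differentiable_on {t \<in> {0..1} - K2. g2 t \<in> fst c}"
    using g2 unfolding piecewise_C1_path_def by (auto simp: case_prod_beta)
  \<comment> \<open>The exceptional parameters of the two halves, rescaled, together with the joint
    1/2.\<close>
  define K where "K = insert (1/2) ((\<lambda>t. t / 2) ` K1 \<union> (\<lambda>t. (t + 1) / 2) ` K2)"
  have k1: "2 * t \<notin> K1" if "t \<notin> K" for t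
  proof
    assume "2 * t \<in> K1"
    then have "t \<in> K"
      unfolding K_def by (intro insertI2 UnI1 image_eqI[of _ _ "2 * t"]) auto
    with that show False ..
  qed
  have k2: "2 * t - 1 \<notin> K2" if "t \<notin> K" for t
  proof
    assume "2 * t - 1 \<in> K2"
    then have "t \<in> K"
      unfolding K_def by (intro insertI2 UnI2 image_eqI[of _ _ "2 * t - 1"]) auto
    with that show False ..
  qed
  have "(snd c \<circ> (g1 +++ g2)) C1_differentiable_on {t \<in> {0..1} - K. (g1 +++ g2) t \<in> fst c}" if c: "c \<in> A" for c
  proof (rule C1_differentiable_on_split[where a = "1/2"])
    show "(snd c \<circ> (g1 +++ g2)) C1_differentiable_on ({t \<in> {0..1} - K. (g1 +++ g2) t \<in> fst c} \<inter> {..<1/2})"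
      by (rule C1_differentiable_on_affine[OF K1(2)[OF c], where Q = "{..<1/2}" and m = 2 and b = 0])
        (auto simp: joinpaths_def k1)
    show "(snd c \<circ> (g1 +++ g2)) C1_differentiable_on ({t \<in> {0..1} - K. (g1 +++ g2) t \<in> fst c} \<inter> {1/2<..})"
      by (rule C1_differentiable_on_affine[OF K2(2)[OF c], where Q = "{1/2<..}" and m = 2 and b = "-1"])
        (auto simp: joinpaths_def k2)
  qed (simp add: K_def)
  moreover have "finite K"
    using K1 K2 by (simp add: K_def)
  moreover have "path (g1 +++ g2)" "path_image (g1 +++ g2) \<subseteq> X"
    using g1 g2 e unfolding piecewise_C1_path_def by (auto simp: subset_path_image_join)
  ultimately show ?thesis
    unfolding piecewise_C1_path_def by (auto simp: case_prod_beta intro!: exI[of _ K])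
qed

text \<open>In the chart \<open>c\<close> the path is a straight segment, and smooth transition maps
  make it C1 in every other chart.\<close>

lemma piecewise_C1_chart_segment:
  fixes X :: "'a::topological_space set" and A :: "('a, 'e::euclidean_space) chart set"
  assumes m: "smooth_manifold X A" and c: "c \<in> A" and seg: "closed_segment u w \<subseteq> snd c ` fst c"
    and g: "\<And>t. t \<in> {0..1} \<Longrightarrow> g t = chart_inv c (linepath u w t)"
  shows "piecewise_C1_path X A g"
proof -
  note hom = chart_homeomorphism[OF m c]
  have lin: "linepath u w t \<in> snd c ` fst c" if "t \<in> {0..1}" for t
    using seg that by (metis imageI path_image_def path_image_linepath subsetD)
  have ci: "continuous_on (snd c ` fst c) (chart_inv c)" "chart_inv c ` snd c ` fst c = fst c"
    using hom by (auto simp: homeomorphism_def)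
  have cX: "fst c \<subseteq> X"
    using openin_imp_subset[OF chart_domain_openin[OF m c]] .
  have "continuous_on {0..1} (\<lambda>t. chart_inv c (linepath u w t))"
    by (rule continuous_on_compose2[OF ci(1)]) (use lin in \<open>auto simp: image_subset_iff\<close>)
  then have "path g"
    unfolding path_def by (rule continuous_on_eq) (simp add: g)
  moreover have gc: "g t \<in> fst c" if "t \<in> {0..1}" for t
    using lin[OF that] ci(2) g[OF that] by auto
  then have "path_image g \<subseteq> X"
    using cX by (auto simp: path_image_def)
  \<comment> \<open>The end points are exempt: \<open>g\<close> is prescribed on [0,1] only, whereas
    C1 differentiability asks for two-sided derivatives.\<close>
  moreover have "(snd c' \<circ> g) C1_differentiable_on {t \<in> {0..1} - {0, 1}. g t \<in> fst c'}" if c': "c' \<in> A" for c'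
  proof -
    let ?f = "snd c' \<circ> chart_inv c" and ?S = "{t \<in> {0..1} - {0, 1}. g t \<in> fst c'}"
    let ?D = "\<lambda>t. frechet_derivative ?f (at (linepath u w t)) (w - u)"
    note sm = smooth_transition[OF m c c']
    have mem: "linepath u w t \<in> snd c ` (fst c \<inter> fst c')" if t: "t \<in> ?S" for t
    proof -
      have t01: "t \<in> {0..1}" using t by simp
      have "snd c (g t) = linepath u w t"
        using lin[OF t01] hom g[OF t01] by (auto simp: homeomorphism_def)
      then show ?thesis
        using gc[OF t01] t by (metis (no_types, lifting) IntI imageI mem_Collect_eq)
    qed
    have "((snd c' \<circ> g) has_vector_derivative ?D t) (at t)" if t: "t \<in> ?S" for t
    proof -
      have "(?f has_derivative frechet_derivative ?f (at (linepath u w t))) (at (linepath u w t))"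
        using smooth_on_differentiable[OF sm mem[OF t]] by (simp add: frechet_derivative_works)
      from vector_derivative_diff_chain_within[OF has_vector_derivative_linepath_within has_derivative_at_withinI[OF this]]
      have "((?f \<circ> linepath u w) has_vector_derivative ?D t) (at t)" .
      then show ?thesis
        by (rule has_vector_derivative_transform_within_open[where S = "{0<..<1}"]) (use t g in auto)
    qed
    moreover have "continuous_on ?S ?D"
      by (rule continuous_on_compose2[OF smooth_on_continuous_frechet_derivative[OF sm]])
        (use mem in \<open>auto simp: image_subset_iff\<close>)
    ultimately show ?thesis
      unfolding C1_differentiable_on_def by (intro exI[of _ ?D] conjI ballI)
  qed
  ultimately show ?thesis
    unfolding piecewise_C1_path_def by (auto simp: case_prod_beta intro!: exI[of _ "{0, 1}"])
qed

section \<open>Line integrals and primitives on the cover\<close>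

lemma smooth_map_on_differentiable:
  assumes "smooth_map_on A B D f" "c \<in> A" "c' \<in> B" "p \<in> fst c" "p \<in> D" "f p \<in> fst c'"
  shows "(snd c' \<circ> f \<circ> chart_inv c) differentiable (at (snd c p))"
proof -
  have "\<forall>(U, \<phi>)\<in>A. \<forall>(V, \<psi>)\<in>B. smooth_on (\<phi> ` (U \<inter> D \<inter> f -` V)) (\<psi> \<circ> f \<circ> chart_inv (U, \<phi>))"
    using assms(1) by (simp add: smooth_map_on_def)
  from bspec[OF this assms(2)]
  have "\<forall>(V, \<psi>)\<in>B. smooth_on (snd c ` (fst c \<inter> D \<inter> f -` V)) (\<psi> \<circ> f \<circ> chart_inv c)"
    by (simp add: case_prod_beta)
  from bspec[OF this assms(3)]
  have "smooth_on (snd c ` (fst c \<inter> D \<inter> f -` fst c')) (snd c' \<circ> f \<circ> chart_inv c)"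
    by (simp add: case_prod_beta)
  then show ?thesis
    by (rule smooth_on_differentiable) (use assms(4-6) in blast)
qed

locale smooth_cover =
  fixes X :: "'a::topological_space set" and A :: "('a, 'e::euclidean_space) chart set"
    and Y :: "'b::topological_space set" and B :: "('b, 'e) chart set"
    and \<pi> :: "'b \<Rightarrow> 'a"
  assumes X_manifold: "smooth_manifold X A"
    and universal: "smooth_universal_cover X A Y B \<pi>"
begin

lemma Y_manifold: "smooth_manifold Y B"
  and covering: "covering_space Y \<pi> X"
  and Y_simply_connected: "simply_connected Y"
  and local_diffeo: "local_diffeomorphism Y B X A \<pi>"
  using universal by (auto simp: smooth_universal_cover_def)

lemma \<pi>_in: "y \<in> Y \<Longrightarrow> \<pi> y \<in> X"
  using covering_space_imp_surjective[OF covering] by blast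

lemma local_section:
  assumes "y \<in> Y"
  obtains D W \<sigma> where "y \<in> D" "openin (top_of_set Y) D" "openin (top_of_set X) W" "homeomorphism D W \<pi> \<sigma>"
    "smooth_map_on B A D \<pi>" "smooth_map_on A B W \<sigma>"
  using bspec[OF local_diffeo[unfolded local_diffeomorphism_def] assms] by metis

text \<open>The equation between the differential of \<open>h\<close> and the pullback holds on the
  cover; composing \<open>h\<close> with a local section \<sigma> of \<pi> turns it into a statement
  in a chart of \<open>X\<close>. Both the evaluation of line integrals and the descent of
  \<open>h\<close> to \<open>X\<close> rest on this form.\<close>

lemma primitive_section_derivative:
  assumes \<alpha>: "one_form A \<alpha>" and h: "is_primitive A B \<pi> \<alpha> h"
    and y: "y \<in> Y" and c: "c \<in> A" "\<pi> y \<in> fst c"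
  obtains D W \<sigma> where "y \<in> D" "openin (top_of_set Y) D" "openin (top_of_set X) W" "homeomorphism D W \<pi> \<sigma>"
    "((h \<circ> \<sigma> \<circ> chart_inv c) has_derivative \<alpha> c (\<pi> y)) (at (snd c (\<pi> y)))"
proof -
  obtain D W \<sigma> where D: "y \<in> D" "openin (top_of_set Y) D" and W: "openin (top_of_set X) W"
    and hom: "homeomorphism D W \<pi> \<sigma>" and s\<pi>: "smooth_map_on B A D \<pi>" and s\<sigma>: "smooth_map_on A B W \<sigma>"
    using local_section[OF y] by metis
  define d where "d = chart_at B y"
  define c' where "c' = chart_at A (\<pi> y)"
  have d: "d \<in> B" "y \<in> fst d"
    using chart_at_mem[OF Y_manifold y] by (auto simp: d_def)
  have c': "c' \<in> A" "\<pi> y \<in> fst c'"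
    using chart_at_mem[OF X_manifold \<pi>_in[OF y]] by (auto simp: c'_def)
  have \<sigma>y: "\<sigma> (\<pi> y) = y" and \<pi>W: "\<pi> y \<in> W" and \<pi>\<sigma>: "\<And>x. x \<in> W \<Longrightarrow> \<pi> (\<sigma> x) = x"
    and \<sigma>_cont: "continuous_on W \<sigma>" and \<sigma>W: "\<sigma> ` W = D"
    using hom D(1) by (auto simp: homeomorphism_def)
  let ?a = "snd c (\<pi> y)" and ?b = "snd d y"
  let ?f1 = "snd d \<circ> \<sigma> \<circ> chart_inv c" and ?f2 = "snd c' \<circ> \<pi> \<circ> chart_inv d" and ?f3 = "h \<circ> chart_inv d"
  \<comment> \<open>On \<open>Q\<close> the chart \<open>c\<close>, the section, and the chart
    \<open>d\<close> of the cover after it are all defined. Its image is open, so equality of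
    composites there transfers derivatives.\<close>
  define Q where "Q = fst c \<inter> (W \<inter> \<sigma> -` fst d)"
  have DY: "D \<subseteq> Y"
    using openin_imp_subset[OF D(2)] .
  have "openin (top_of_set W) (W \<inter> \<sigma> -` fst d)"
    using chart_domain_openin[OF Y_manifold d(1)] \<sigma>_cont \<sigma>W DY
    by (intro continuous_openin_preimage[where T = Y]) auto
  then have "openin (top_of_set X) Q"
    unfolding Q_def by (rule openin_Int[OF chart_domain_openin[OF X_manifold c(1)] openin_trans[OF _ W]])
  then have Q: "open (snd c ` Q)"
    by (rule chart_image_openin[OF X_manifold c(1)]) (simp add: Q_def)
  have aQ: "?a \<in> snd c ` Q"
    using c d \<pi>W \<sigma>y by (auto simp: Q_def)
  have ci: "chart_inv c (snd c x) = x" if "x \<in> Q" for x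
    using chart_inv_apply[OF X_manifold c(1)] that by (simp add: Q_def)
  have di: "chart_inv d (snd d (\<sigma> x)) = \<sigma> x" if "x \<in> Q" for x
    using chart_inv_apply[OF Y_manifold d(1)] that by (simp add: Q_def)
  have f1: "?f1 differentiable (at ?a)"
    by (rule smooth_map_on_differentiable[OF s\<sigma> c(1) d(1) c(2)]) (use \<pi>W \<sigma>y d in auto)
  have f1a: "?f1 ?a = ?b"
    using \<sigma>y chart_inv_apply[OF X_manifold c] by simp
  have f2: "?f2 differentiable (at ?b)"
    by (rule smooth_map_on_differentiable[OF s\<pi> d(1) c'(1) d(2) D(1) c'(2)])
  have f3: "?f3 differentiable (at ?b)"
    using h d by (intro smooth_on_differentiable[OF smooth_fun_chart[of B]]) (auto simp: is_primitive_def)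
  let ?D1 = "frechet_derivative ?f1 (at ?a)" and ?D2 = "frechet_derivative ?f2 (at ?b)"
    and ?D3 = "frechet_derivative ?f3 (at ?b)"
  have D1: "(?f1 has_derivative ?D1) (at ?a)"
    using f1 by (simp only: frechet_derivative_works)
  have D2: "(?f2 has_derivative ?D2) (at (?f1 ?a))"
    using f2 unfolding f1a by (simp only: frechet_derivative_works)
  have D3: "(?f3 has_derivative ?D3) (at (?f1 ?a))"
    using f3 unfolding f1a by (simp only: frechet_derivative_works)
  have "((snd c' \<circ> chart_inv c) has_derivative ?D2 \<circ> ?D1) (at ?a)"
  proof (rule has_derivative_transform_within_open[OF diff_chain_at[OF D1 D2] Q aQ])
    fix z assume "z \<in> snd c ` Q"
    then show "(?f2 \<circ> ?f1) z = (snd c' \<circ> chart_inv c) z"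
      using ci di \<pi>\<sigma> by (auto simp: Q_def)
  qed
  then have trans: "frechet_derivative (snd c' \<circ> chart_inv c) (at ?a) = ?D2 \<circ> ?D1"
    by (rule frechet_derivative_at[symmetric])
  have "((h \<circ> \<sigma> \<circ> chart_inv c) has_derivative ?D3 \<circ> ?D1) (at ?a)"
  proof (rule has_derivative_transform_within_open[OF diff_chain_at[OF D1 D3] Q aQ])
    fix z assume "z \<in> snd c ` Q"
    then show "(?f3 \<circ> ?f1) z = (h \<circ> \<sigma> \<circ> chart_inv c) z"
      using ci di by auto
  qed
  moreover have "(?D3 \<circ> ?D1) v = \<alpha> c (\<pi> y) v" for v
  proof -
    have "form_eq B (differential h) (pullback A \<pi> \<alpha>)"
      using h by (simp add: is_primitive_def)
    then have "differential h d y (?D1 v) = pullback A \<pi> \<alpha> d y (?D1 v)"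
      using d by (simp add: form_eq_def)
    then have "?D3 (?D1 v) = \<alpha> c' (\<pi> y) (?D2 (?D1 v))"
      by (simp add: differential_def pullback_def Let_def flip: c'_def)
    \<comment> \<open>\<open>c'\<close> is the chart that \<open>pullback\<close> picks around
      \<open>\<pi> y\<close>. By \<open>trans\<close>, \<open>?D2 \<circ> ?D1\<close> is the
      derivative of the transition from \<open>c\<close> to \<open>c'\<close>, so compatibility of
      the local expressions leads back to \<open>c\<close>.\<close>
    also have "\<dots> = \<alpha> c (\<pi> y) v"
    proof -
      have "\<forall>c\<in>A. \<forall>c'\<in>A. \<forall>p\<in>fst c \<inter> fst c'. \<forall>v.
          \<alpha> c p v = \<alpha> c' p (frechet_derivative (snd c' \<circ> chart_inv c) (at (snd c p)) v)"
        using \<alpha> unfolding one_form_def by (elim conjE)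
      from this[rule_format, OF c(1) c'(1), of "\<pi> y" v] show ?thesis
        using c c' trans by simp
    qed
    finally show ?thesis by simp
  qed
  then have "?D3 \<circ> ?D1 = \<alpha> c (\<pi> y)" ..
  ultimately show ?thesis
    using that[OF D W hom] by simp
qed

text \<open>Smoothness is demanded of the projected path, because line integrals are taken on
  \<open>X\<close>.\<close>

definition C1_lift :: "(real \<Rightarrow> 'b) \<Rightarrow> 'b \<Rightarrow> 'b \<Rightarrow> bool" where
  "C1_lift l y z \<longleftrightarrow> path l \<and> path_image l \<subseteq> Y \<and> pathstart l = y \<and> pathfinish l = z \<and>
     piecewise_C1_path X A (\<pi> \<circ> l)"

lemma C1_lift_join:
  assumes "C1_lift l y z" "C1_lift m z w"
  shows "C1_lift (l +++ m) y w"
proof -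
  have "piecewise_C1_path X A ((\<pi> \<circ> l) +++ (\<pi> \<circ> m))"
    using assms by (intro piecewise_C1_path_join) (auto simp: C1_lift_def pathfinish_compose pathstart_compose)
  then show ?thesis
    using assms by (auto simp: C1_lift_def path_compose_join subset_path_image_join)
qed

text \<open>A coordinate ball of \<open>X\<close> is carried up by a local section; straight
  segments stay in the ball and project to piecewise C1 paths. The same neighbourhoods serve local
  path-connectedness of the cover and the joining of distant points.\<close>

lemma C1_lift_local:
  assumes N: "openin (top_of_set Y) N" "y \<in> N"
  shows "\<exists>D. openin (top_of_set Y) D \<and> y \<in> D \<and> D \<subseteq> N \<and>
    (\<forall>z\<in>D. \<forall>w\<in>D. \<exists>l. C1_lift l z w \<and> path_image l \<subseteq> D)"
proof -
  have NY: "N \<subseteq> Y" and y: "y \<in> Y"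
    using openin_imp_subset[OF N(1)] N(2) by auto
  obtain D W \<sigma> where D: "y \<in> D" "openin (top_of_set Y) D" and W: "openin (top_of_set X) W"
    and hom: "homeomorphism D W \<pi> \<sigma>"
    using local_section[OF y] by metis
  have \<sigma>y: "\<sigma> (\<pi> y) = y" and \<pi>W: "\<pi> y \<in> W" and \<pi>\<sigma>: "\<And>x. x \<in> W \<Longrightarrow> \<pi> (\<sigma> x) = x"
    and \<sigma>_cont: "continuous_on W \<sigma>" and \<sigma>W: "\<sigma> ` W = D"
    using hom D(1) by (auto simp: homeomorphism_def)
  have DY: "D \<subseteq> Y"
    using openin_imp_subset[OF D(2)] .
  define c where "c = chart_at A (\<pi> y)"
  have c: "c \<in> A" "\<pi> y \<in> fst c"
    using chart_at_mem[OF X_manifold \<pi>_in[OF y]] by (auto simp: c_def)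
  define V where "V = fst c \<inter> (W \<inter> \<sigma> -` N)"
  have "openin (top_of_set W) (W \<inter> \<sigma> -` N)"
    using N(1) \<sigma>_cont \<sigma>W DY by (intro continuous_openin_preimage[where T = Y]) auto
  then have VX: "openin (top_of_set X) V"
    unfolding V_def by (rule openin_Int[OF chart_domain_openin[OF X_manifold c(1)] openin_trans[OF _ W]])
  then have "open (snd c ` V)"
    by (rule chart_image_openin[OF X_manifold c(1)]) (simp add: V_def)
  moreover have "snd c (\<pi> y) \<in> snd c ` V"
    using c N \<pi>W \<sigma>y by (auto simp: V_def)
  ultimately obtain e where e: "e > 0" "ball (snd c (\<pi> y)) e \<subseteq> snd c ` V"
    using open_contains_ball by blast
  let ?ball = "ball (snd c (\<pi> y)) e"
  have hc: "homeomorphism (fst c) (snd c ` fst c) (snd c) (chart_inv c)"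
    using chart_homeomorphism[OF X_manifold c(1)] .
  have ball_sub: "?ball \<subseteq> snd c ` fst c"
    using e(2) by (auto simp: V_def)
  define M where "M = chart_inv c ` ?ball"
  have MV: "M \<subseteq> V"
    using image_mono[OF e(2), of "chart_inv c"] chart_inv_apply[OF X_manifold c(1)]
    by (force simp: M_def V_def)
  have ballM: "snd c ` M = ?ball"
  proof -
    have "snd c (chart_inv c z) = z" if "z \<in> ?ball" for z
      using homeomorphism_apply2[OF hc subsetD[OF ball_sub that]] .
    then show ?thesis
      by (simp add: M_def image_image del: mem_ball)
  qed
  have "openin (top_of_set (snd c ` fst c)) ?ball"
    using ball_sub by (simp add: openin_open_eq chart_image_open[OF X_manifold c(1)])
  then have "openin (top_of_set (fst c)) M"
    unfolding M_def using homeomorphism_imp_open_map[OF homeomorphism_symD[OF hc]] by blast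
  then have MX: "openin (top_of_set X) M"
    using openin_trans chart_domain_openin[OF X_manifold c(1)] by blast
  have MW: "M \<subseteq> W"
    using MV by (auto simp: V_def)
  have "openin (top_of_set W) M"
    by (rule openin_subset_trans[OF MX MW openin_imp_subset[OF W]])
  then have "openin (top_of_set D) (\<sigma> ` M)"
    using homeomorphism_imp_open_map[OF homeomorphism_symD[OF hom]] by blast
  then have open_D: "openin (top_of_set Y) (\<sigma> ` M)"
    using openin_trans D(2) by blast
  have "chart_inv c (snd c (\<pi> y)) \<in> M"
    using e(1) by (simp add: M_def)
  then have "\<pi> y \<in> M"
    using chart_inv_apply[OF X_manifold c] by simp
  then have yM: "y \<in> \<sigma> ` M"
    using \<sigma>y by (metis imageI)
  have "\<exists>l. C1_lift l z w \<and> path_image l \<subseteq> \<sigma> ` M" if z: "z \<in> \<sigma> ` M" and w: "w \<in> \<sigma> ` M" for z w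
  proof -
    obtain z' where z': "z' \<in> ?ball" "z = \<sigma> (chart_inv c z')"
      using z by (auto simp: M_def)
    obtain w' where w': "w' \<in> ?ball" "w = \<sigma> (chart_inv c w')"
      using w by (auto simp: M_def)
    have seg: "closed_segment z' w' \<subseteq> ?ball"
      using z' w' convex_ball by (intro closed_segment_subset) auto
    let ?l = "\<sigma> \<circ> (chart_inv c \<circ> linepath z' w')"
    have lin: "chart_inv c (linepath z' w' t) \<in> M" if "t \<in> {0..1}" for t
      using seg that unfolding M_def by (intro imageI) (metis imageI path_image_def path_image_linepath subsetD)
    have "path (chart_inv c \<circ> linepath z' w')"
      using hc seg ball_sub
      by (intro path_continuous_image path_linepath) (auto simp: homeomorphism_def intro: continuous_on_subset)
    moreover have im: "path_image (chart_inv c \<circ> linepath z' w') \<subseteq> M"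
      using lin by (auto simp: path_image_def)
    ultimately have "path ?l"
      by (intro path_continuous_image[OF _ continuous_on_subset[OF \<sigma>_cont]] order_trans[OF im MW])
    moreover have limg: "path_image ?l \<subseteq> \<sigma> ` M"
      using im by (auto simp: path_image_compose)
    moreover have "path_image ?l \<subseteq> Y"
      using limg openin_imp_subset[OF open_D] by (rule order_trans)
    moreover have "pathstart ?l = z" "pathfinish ?l = w"
      using z' w' by (simp_all add: pathstart_compose pathfinish_compose)
    moreover have "piecewise_C1_path X A (\<pi> \<circ> ?l)"
    proof (rule piecewise_C1_chart_segment[OF X_manifold c(1)])
      show "closed_segment z' w' \<subseteq> snd c ` fst c"
        using seg ball_sub by blast
      show "(\<pi> \<circ> ?l) t = chart_inv c (linepath z' w' t)" if "t \<in> {0..1}" for t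
        using \<pi>\<sigma> lin[OF that] MW by auto
    qed
    ultimately have "C1_lift ?l z w"
      unfolding C1_lift_def by (intro conjI)
    then show ?thesis
      using limg by blast
  qed
  moreover have "\<sigma> ` M \<subseteq> N"
    using MV by (auto simp: V_def)
  ultimately show ?thesis
    using open_D yM by (intro exI[of _ "\<sigma> ` M"] conjI ballI) auto
qed

text \<open>This makes the purely topological results of \<open>based_cover\<close> available for
  the manifold.\<close>

lemma Y_locally_path_connected: "locally path_connected Y"
  unfolding locally_def
proof (intro allI impI)
  fix N y assume "openin (top_of_set Y) N \<and> y \<in> N"
  then obtain D where D: "openin (top_of_set Y) D" "y \<in> D" "D \<subseteq> N"
    "\<And>z w. z \<in> D \<Longrightarrow> w \<in> D \<Longrightarrow> \<exists>l. C1_lift l z w \<and> path_image l \<subseteq> D"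
    using C1_lift_local by metis
  have "path_connected D"
    unfolding path_connected_def
  proof (intro ballI)
    fix z w assume "z \<in> D" "w \<in> D"
    from D(4)[OF this] show "\<exists>g. path g \<and> path_image g \<subseteq> D \<and> pathstart g = z \<and> pathfinish g = w"
      by (auto simp: C1_lift_def)
  qed
  with D(1-3) show "\<exists>U V. openin (top_of_set Y) U \<and> path_connected V \<and> y \<in> U \<and> U \<subseteq> V \<and> V \<subseteq> N"
    by (intro exI[of _ D] conjI order_refl)
qed

text \<open>The set of points reachable from \<open>y\<close> is clopen in the connected cover: by
  \<open>C1_lift_local\<close>, the points of a small open set are reachable all together or not at
  all.\<close>

lemma C1_lift_exists:
  assumes y: "y \<in> Y" and z: "z \<in> Y"
  obtains l where "C1_lift l y z"
proof -
  define R where "R = {w \<in> Y. \<exists>l. C1_lift l y w}"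
  have loc: "\<exists>D. openin (top_of_set Y) D \<and> w \<in> D \<and> (\<forall>u\<in>D. u \<in> R \<longleftrightarrow> w \<in> R)" if w: "w \<in> Y" for w
  proof -
    obtain D where D: "openin (top_of_set Y) D" "w \<in> D"
      "\<And>u v. u \<in> D \<Longrightarrow> v \<in> D \<Longrightarrow> \<exists>l. C1_lift l u v"
      using C1_lift_local[of Y w] w openin_subtopology_self by metis
    have "u \<in> R \<longleftrightarrow> w \<in> R" if u: "u \<in> D" for u
    proof -
      obtain l m where lm: "C1_lift l u w" "C1_lift m w u"
        using D(3)[OF u D(2)] D(3)[OF D(2) u] by auto
      then show ?thesis
        using w subsetD[OF openin_imp_subset[OF D(1)] u]
        by (auto simp: R_def dest: C1_lift_join[OF _ lm(1)] C1_lift_join[OF _ lm(2)])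
    qed
    then show ?thesis
      using D by (intro exI[of _ D] conjI ballI)
  qed
  have "openin (top_of_set Y) R"
  proof (subst openin_subopen, intro ballI)
    fix w assume w: "w \<in> R"
    then obtain D where "openin (top_of_set Y) D" "w \<in> D" "\<forall>u\<in>D. u \<in> R \<longleftrightarrow> w \<in> R"
      using loc[of w] by (auto simp: R_def)
    then show "\<exists>D. openin (top_of_set Y) D \<and> w \<in> D \<and> D \<subseteq> R"
      using w by (intro exI[of _ D]) auto
  qed
  moreover have "openin (top_of_set Y) (Y - R)"
  proof (subst openin_subopen, intro ballI)
    fix w assume w: "w \<in> Y - R"
    then obtain D where D: "openin (top_of_set Y) D" "w \<in> D" "\<forall>u\<in>D. u \<in> R \<longleftrightarrow> w \<in> R"
      using loc[of w] by auto
    have "u \<in> Y - R" if "u \<in> D" for u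
      using D(3) w subsetD[OF openin_imp_subset[OF D(1)] that] that by auto
    then have "D \<subseteq> Y - R" ..
    with D(1,2) show "\<exists>D. openin (top_of_set Y) D \<and> w \<in> D \<and> D \<subseteq> Y - R"
      by (intro exI[of _ D] conjI)
  qed
  then have "closedin (top_of_set Y) R"
    by (auto simp: closedin_def R_def)
  moreover have "connected Y"
    using Y_simply_connected by (intro path_connected_imp_connected simply_connected_path_connected)
  ultimately have "R = {} \<or> R = Y"
    by (auto simp: connected_clopen)
  moreover have "y \<in> R"
    using C1_lift_local[of Y y] y openin_subtopology_self unfolding R_def by blast
  ultimately have "z \<in> R"
    using z by auto
  then show ?thesis
    using that by (auto simp: R_def)
qed

text \<open>Since \<beta> is \<alpha> plus the differential of \<open>f\<close>, the function h (l
  t) + f (g t) is an antiderivative of the integrand off a finite set. Any lift of \<open>g\<close>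
  may be used, so two lifts of the same path can be compared through one integral.\<close>

lemma line_integral_lift:
  assumes \<alpha>: "one_form A \<alpha>" and h: "is_primitive A B \<pi> \<alpha> h"
    and f: "smooth_fun A f" "form_eq A (\<lambda>c p v. \<beta> c p v - \<alpha> c p v) (differential f)"
    and g: "piecewise_C1_path X A g" and l: "path l" "path_image l \<subseteq> Y" "\<And>t. t \<in> {0..1} \<Longrightarrow> \<pi> (l t) = g t"
  shows "line_integral A \<beta> g = h (pathfinish l) - h (pathstart l) + (f (pathfinish g) - f (pathstart g))"
proof -
  obtain K where K: "finite K" "\<And>c. c \<in> A \<Longrightarrow> (snd c \<circ> g) C1_differentiable_on {t \<in> {0..1} - K. g t \<in> fst c}"
    using g unfolding piecewise_C1_path_def by (auto simp: case_prod_beta)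
  have gX: "g t \<in> X" if "t \<in> {0..1}" for t
    using g that unfolding piecewise_C1_path_def path_image_def by auto
  have lY: "l t \<in> Y" if "t \<in> {0..1}" for t
    using l(2) that by (auto simp: path_image_def)
  have g_cont: "continuous_on {0..1} g" and l_cont: "continuous_on {0..1} l"
    using g l(1) by (auto simp: piecewise_C1_path_def path_def)
  let ?F = "\<lambda>t. h (l t) + f (g t)"
  let ?\<omega> = "\<lambda>t. let c = chart_at A (g t) in \<beta> c (g t) (vector_derivative (snd c \<circ> g) (at t))"
  \<comment> \<open>The chart chosen by \<open>chart_at\<close> may jump with \<open>t\<close>; the
    derivative is therefore found pointwise, in whichever chart is chosen at that parameter.\<close>
  have "(?F has_vector_derivative ?\<omega> t) (at t)" if t: "t \<in> {0<..<1} - K" for t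
  proof -
    have t01: "t \<in> {0..1}" using t by simp
    define c where "c = chart_at A (g t)"
    have c: "c \<in> A" "g t \<in> fst c"
      using chart_at_mem[OF X_manifold gX[OF t01]] by (auto simp: c_def)
    have \<pi>l: "\<pi> (l t) = g t"
      using l(3)[OF t01] .
    define w where "w = vector_derivative (snd c \<circ> g) (at t)"
    have "(snd c \<circ> g) differentiable (at t)"
      using K(2)[OF c(1)] t c(2) by (auto simp: C1_differentiable_on_eq)
    then have w: "((snd c \<circ> g) has_vector_derivative w) (at t)"
      unfolding w_def by (simp only: vector_derivative_works)
    obtain D W \<sigma> where D: "l t \<in> D" "openin (top_of_set Y) D" and hom: "homeomorphism D W \<pi> \<sigma>"
      and der: "((h \<circ> \<sigma> \<circ> chart_inv c) has_derivative \<alpha> c (\<pi> (l t))) (at (snd c (\<pi> (l t))))"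
      using primitive_section_derivative[OF \<alpha> h lY[OF t01] c(1)] c(2) \<pi>l by metis
    have der': "((h \<circ> \<sigma> \<circ> chart_inv c) has_derivative \<alpha> c (g t)) (at ((snd c \<circ> g) t))"
      using der \<pi>l by simp
    define Q where "Q = ({0<..<1} \<inter> l -` D) \<inter> ({0<..<1} \<inter> g -` fst c)"
    have sub: "{0<..<1} \<subseteq> {0..1::real}" by auto
    have "openin (top_of_set {0<..<1}) Q"
      unfolding Q_def
    proof (rule openin_Int)
      show "openin (top_of_set {0<..<1}) ({0<..<1} \<inter> l -` D)"
        using lY by (intro continuous_openin_preimage[OF continuous_on_subset[OF l_cont sub] _ D(2)]) auto
      show "openin (top_of_set {0<..<1}) ({0<..<1} \<inter> g -` fst c)"
        using gX by (intro continuous_openin_preimage[OF continuous_on_subset[OF g_cont sub] _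
            chart_domain_openin[OF X_manifold c(1)]]) auto
    qed
    then have Q: "open Q"
      by (rule openin_open_trans) simp
    have tQ: "t \<in> Q"
      using t D c by (simp add: Q_def)
    have ci: "chart_inv c (snd c (g s)) = g s" if "s \<in> Q" for s
      using that by (intro chart_inv_apply[OF X_manifold c(1)]) (simp add: Q_def)
    have "((h \<circ> \<sigma> \<circ> chart_inv c) \<circ> (snd c \<circ> g) has_vector_derivative \<alpha> c (g t) w) (at t)"
      by (rule vector_derivative_diff_chain_within[OF w has_derivative_at_withinI[OF der']])
    then have 1: "((\<lambda>t. h (l t)) has_vector_derivative \<alpha> c (g t) w) (at t)"
    proof (rule has_vector_derivative_transform_within_open[OF _ Q tQ])
      fix s assume s: "s \<in> Q"
      then have "\<pi> (l s) = g s" "\<sigma> (\<pi> (l s)) = l s"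
        using l(3)[of s] hom by (auto simp: Q_def homeomorphism_def)
      then show "((h \<circ> \<sigma> \<circ> chart_inv c) \<circ> (snd c \<circ> g)) s = h (l s)"
        using ci[OF s] by simp
    qed
    have "(f \<circ> chart_inv c) differentiable (at (snd c (g t)))"
      using c by (intro smooth_on_differentiable[OF smooth_fun_chart[OF f(1)]]) auto
    then have "((f \<circ> chart_inv c) has_derivative differential f c (g t)) (at ((snd c \<circ> g) t))"
      by (simp add: frechet_derivative_works differential_def[abs_def])
    from vector_derivative_diff_chain_within[OF w has_derivative_at_withinI[OF this]]
    have "((f \<circ> chart_inv c) \<circ> (snd c \<circ> g) has_vector_derivative differential f c (g t) w) (at t)" .
    then have 2: "((\<lambda>t. f (g t)) has_vector_derivative differential f c (g t) w) (at t)"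
      by (rule has_vector_derivative_transform_within_open[OF _ Q tQ]) (simp add: ci)
    have "\<beta> c (g t) w - \<alpha> c (g t) w = differential f c (g t) w"
      using f(2) c unfolding form_eq_def by blast
    then have "?\<omega> t = \<alpha> c (g t) w + differential f c (g t) w"
      by (simp add: Let_def flip: c_def w_def)
    with has_vector_derivative_add[OF 1 2] show ?thesis
      by simp
  qed
  moreover have "continuous_on {0..1} ?F"
  proof (intro continuous_on_add)
    show "continuous_on {0..1} (\<lambda>t. h (l t))"
      using h l by (intro continuous_on_compose2[OF smooth_fun_continuous[OF Y_manifold] l_cont])
        (auto simp: is_primitive_def path_image_def)
    show "continuous_on {0..1} (\<lambda>t. f (g t))"
      using gX by (intro continuous_on_compose2[OF smooth_fun_continuous[OF X_manifold f(1)] g_cont]) auto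
  qed
  ultimately have "(?\<omega> has_integral ?F 1 - ?F 0) {0..1}"
    by (intro fundamental_theorem_of_calculus_interior_strong[OF K(1)]) auto
  then show ?thesis
    unfolding line_integral_def by (simp add: integral_unique pathstart_def pathfinish_def)
qed

end

section \<open>Connectedness of the half-space subgraph\<close>

lemma closedin_Int_subspace:
  assumes "closedin (top_of_set Y) A" "N \<subseteq> Y"
  shows "closedin (top_of_set N) (N \<inter> A)"
proof -
  obtain K where K: "closed K" "A = Y \<inter> K"
    using assms(1) unfolding closedin_closed by metis
  then have "N \<inter> A = N \<inter> K"
    using assms(2) by auto
  then show ?thesis
    using closedin_closed_Int[OF K(1), of N] by simp
qed

section \<open>Additive characters\<close>

lemma additive_charactersD:
  assumes "\<theta> \<in> additive_characters G" "g \<in> carrier G" "h \<in> carrier G"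
  shows "\<theta> (g \<otimes>\<^bsub>G\<^esub> h) = \<theta> g + \<theta> h"
  using assms by (simp add: additive_characters_def)

lemma
  assumes "group G" "\<theta> \<in> additive_characters G"
  shows additive_character_one: "\<theta> \<one>\<^bsub>G\<^esub> = 0"
    and additive_character_inv: "g \<in> carrier G \<Longrightarrow> \<theta> (inv\<^bsub>G\<^esub> g) = - \<theta> g"
proof -
  interpret group G by fact
  show one: "\<theta> \<one>\<^bsub>G\<^esub> = 0"
    using additive_charactersD[OF assms(2), of "\<one>\<^bsub>G\<^esub>" "\<one>\<^bsub>G\<^esub>"] by simp
  show "\<theta> (inv\<^bsub>G\<^esub> g) = - \<theta> g" if "g \<in> carrier G"
    using additive_charactersD[OF assms(2), of g "inv\<^bsub>G\<^esub> g"] that one by simp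
qed

text \<open>A nonzero value is made positive by passing to the inverse if necessary, and powers of
  that element then have arbitrarily large values.\<close>

lemma additive_character_unbounded:
  assumes "group G" "\<theta> \<in> additive_characters G" "\<exists>g\<in>carrier G. \<theta> g \<noteq> 0"
  shows "\<exists>g\<in>carrier G. \<theta> g \<ge> r"
proof -
  interpret group G by fact
  obtain g where g: "g \<in> carrier G" "\<theta> g > 0"
    using assms additive_character_inv[OF assms(1,2)] by (metis inv_closed linorder_neqE_linordered_idom neg_0_less_iff_less)
  have pow: "\<theta> (g [^]\<^bsub>G\<^esub> n) = real n * \<theta> g" for n :: nat
    using g by (induction n)
      (simp_all add: additive_character_one[OF assms(1,2)] additive_charactersD[OF assms(2)] algebra_simps)
  obtain n :: nat where "real n * \<theta> g \<ge> r"
    using reals_Archimedean3[OF g(2)] less_imp_le by blast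
  then show ?thesis
    using g pow by (intro bexI[of _ "g [^]\<^bsub>G\<^esub> n"]) auto
qed

text \<open>The tile of \<open>g\<close> is the translate of the closed domain by \<open>g\<^sup>-\<^sup>1\<close>, so that the indices of
  touching tiles differ by a left multiplication, as in the Cayley graph.\<close>

lemma BNS_setI:
  fixes G :: "('g, 'm) monoid_scheme" and Y :: "'b::topological_space set" and h :: "'b \<Rightarrow> real"
  assumes G: "group G" and \<theta>: "\<theta> \<in> additive_characters G" "\<exists>g\<in>carrier G. \<theta> g \<noteq> 0"
    and act_cont: "\<And>g. g \<in> carrier G \<Longrightarrow> continuous_on Y (act g)"
    and act_in: "\<And>g y. g \<in> carrier G \<Longrightarrow> y \<in> Y \<Longrightarrow> act g y \<in> Y"
    and act_mult: "\<And>g k y. g \<in> carrier G \<Longrightarrow> k \<in> carrier G \<Longrightarrow> y \<in> Y \<Longrightarrow> act (g \<otimes>\<^bsub>G\<^esub> k) y = act g (act k y)"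
    and act_one: "\<And>y. y \<in> Y \<Longrightarrow> act \<one>\<^bsub>G\<^esub> y = y"
    and h_cont: "continuous_on Y h"
    and h_act: "\<And>g y. g \<in> carrier G \<Longrightarrow> y \<in> Y \<Longrightarrow> h (act g y) = h y - \<theta> g"
    and fd: "fundamental_domain G act Y \<Phi>" and gf: "geometrically_finite G act Y \<Phi>"
    and bdd: "bdd_above (h ` \<Phi>)" and con: "connected {y \<in> Y. h y \<ge> 0}" and ne: "Y \<noteq> {}"
  shows "character_ray G \<theta> \<in> BNS_set G"
proof -
  interpret group G by fact
  define C where "C = Abstract_Topology.closure_of (top_of_set Y) \<Phi>"
  define T where "T g = act (inv\<^bsub>G\<^esub> g) ` C" for g
  define N where "N = {y \<in> Y. h y \<ge> 0}"
  note chi_mult = additive_charactersD[OF \<theta>(1)]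
  note chi_inv = additive_character_inv[OF G \<theta>(1)]
  have \<Phi>_open: "openin (top_of_set Y) \<Phi>" and cov: "(\<Union>g\<in>carrier G. act g ` C) = Y"
    and locfin: "\<And>y. y \<in> Y \<Longrightarrow> \<exists>V. openin (top_of_set Y) V \<and> y \<in> V \<and> finite {g \<in> carrier G. act g ` C \<inter> V \<noteq> {}}"
    using fd unfolding fundamental_domain_def C_def by simp_all
  have \<Phi>Y: "\<Phi> \<subseteq> Y"
    using openin_imp_subset[OF \<Phi>_open] .
  have CY: "C \<subseteq> Y" and C_closed: "closedin (top_of_set Y) C" and \<Phi>C: "\<Phi> \<subseteq> C"
    using closure_of_subset_topspace[of "top_of_set Y" \<Phi>] closure_of_subset[of \<Phi> "top_of_set Y"] \<Phi>Y
    by (auto simp: C_def)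
  have "\<Phi> \<noteq> {}"
    using cov ne by (auto simp: C_def)
  then obtain p0 where p0: "p0 \<in> \<Phi>" by blast
  obtain c where c: "\<And>y. y \<in> \<Phi> \<Longrightarrow> h y \<le> c"
    using bdd by (auto simp: bdd_above_def)
  \<comment> \<open>The bound passes from \<Phi> to its closure, since {h <= c} is closed in
    \<open>Y\<close>.\<close>
  have "C \<subseteq> Y \<inter> h -` {..c}"
    unfolding C_def using c \<Phi>Y
    by (intro closure_of_minimal continuous_closedin_preimage h_cont) auto
  then have hC: "h y \<le> c" if "y \<in> C" for y
    using that by auto
  \<comment> \<open>Two signs cancel: the tile of \<open>g\<close> is the translate by the inverse
    of \<open>g\<close>, and \<open>h_act\<close> subtracts the character.\<close>
  have T_h: "h y \<le> c + \<theta> g" if "g \<in> carrier G" "y \<in> T g" for g y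
    using that CY hC by (auto simp: T_def h_act chi_inv subset_iff)
  have T_Y: "T g \<subseteq> Y" if "g \<in> carrier G" for g
    using that CY act_in by (auto simp: T_def)
  have act_inv: "act g (act (inv\<^bsub>G\<^esub> g) y) = y" "act (inv\<^bsub>G\<^esub> g) (act g y) = y" if "g \<in> carrier G" "y \<in> Y" for g y
    using act_mult[of g "inv\<^bsub>G\<^esub> g" y] act_mult[of "inv\<^bsub>G\<^esub> g" g y] that by (simp_all add: act_one)
  have T_closed: "closedin (top_of_set Y) (T g)" if g: "g \<in> carrier G" for g
  proof -
    have "Y \<subseteq> act g ` Y" "Y \<subseteq> act (inv\<^bsub>G\<^esub> g) ` Y"
      using act_inv g act_in by (metis image_eqI inv_closed subsetI)+
    then have "homeomorphism Y Y (act (inv\<^bsub>G\<^esub> g)) (act g)"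
      using g act_in act_cont act_inv unfolding homeomorphism_def by auto
    then show ?thesis
      unfolding T_def using C_closed homeomorphism_imp_closed_map by blast
  qed
  have T_cover: "\<exists>g\<in>carrier G. y \<in> T g" if "y \<in> Y" for y
  proof -
    have "y \<in> (\<Union>g\<in>carrier G. act g ` C)"
      using cov that by simp
    then obtain g where g: "g \<in> carrier G" "y \<in> act g ` C"
      by (rule UN_E)
    then have "y \<in> T (inv\<^bsub>G\<^esub> g)"
      by (simp add: T_def)
    with g(1) show ?thesis
      by (intro bexI[of _ "inv\<^bsub>G\<^esub> g"] inv_closed)
  qed
  have T_locfin: "\<exists>V. openin (top_of_set Y) V \<and> y \<in> V \<and> finite {g \<in> carrier G. T g \<inter> V \<noteq> {}}" if y: "y \<in> Y" for y
  proof -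
    obtain V where V: "openin (top_of_set Y) V" "y \<in> V" "finite {g \<in> carrier G. act g ` C \<inter> V \<noteq> {}}"
      using locfin[OF y] by blast
    have "{g \<in> carrier G. T g \<inter> V \<noteq> {}} \<subseteq> (\<lambda>g. inv\<^bsub>G\<^esub> g) ` {g \<in> carrier G. act g ` C \<inter> V \<noteq> {}}"
    proof
      fix g assume "g \<in> {g \<in> carrier G. T g \<inter> V \<noteq> {}}"
      then show "g \<in> (\<lambda>g. inv\<^bsub>G\<^esub> g) ` {g \<in> carrier G. act g ` C \<inter> V \<noteq> {}}"
        by (intro image_eqI[of _ _ "inv\<^bsub>G\<^esub> g"]) (auto simp: T_def)
    qed
    from finite_subset[OF this finite_imageI[OF V(3)]] V(1,2) show ?thesis
      by (intro exI[of _ V] conjI)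
  qed
  \<comment> \<open>Local finiteness enters here; it makes both halves of the splitting in
    \<open>chain\<close> closed, whatever their index sets are.\<close>
  have Union_closed: "closedin (top_of_set Y) (\<Union>g\<in>R. T g)" if R: "R \<subseteq> carrier G" for R
  proof (rule closedin_locally_finite_Union)
    show "closedin (top_of_set Y) S" if "S \<in> T ` R" for S
      using that R T_closed by auto
    show "locally_finite_in (top_of_set Y) (T ` R)"
      unfolding locally_finite_in_def
    proof (intro conjI ballI)
      show "\<Union>(T ` R) \<subseteq> topspace (top_of_set Y)"
        using R T_Y by auto
      fix y assume "y \<in> topspace (top_of_set Y)"
      then obtain V where V: "openin (top_of_set Y) V" "y \<in> V" "finite {g \<in> carrier G. T g \<inter> V \<noteq> {}}"
        using T_locfin by auto
      have "{U \<in> T ` R. U \<inter> V \<noteq> {}} \<subseteq> T ` {g \<in> carrier G. T g \<inter> V \<noteq> {}}"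
        using R by auto
      from finite_subset[OF this finite_imageI[OF V(3)]] V(1,2)
      show "\<exists>V. openin (top_of_set Y) V \<and> y \<in> V \<and> finite {U \<in> T ` R. U \<inter> V \<noteq> {}}"
        by (intro exI[of _ V] conjI)
    qed
  qed
  define S0 where "S0 = {g \<in> carrier G - {\<one>\<^bsub>G\<^esub>}. act g ` C \<inter> C \<noteq> {}}"
  have S0_fin: "finite S0" and S0_carrier: "S0 \<subseteq> carrier G"
    using gf by (auto simp: S0_def C_def geometrically_finite_def)
  have S0_inv: "inv\<^bsub>G\<^esub> s \<in> S0" if s: "s \<in> S0" for s
  proof -
    have sG: "s \<in> carrier G" "s \<noteq> \<one>\<^bsub>G\<^esub>" using s by (auto simp: S0_def)
    obtain x where x: "x \<in> C" "act s x \<in> C"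
      using s by (auto simp: S0_def)
    have "act (inv\<^bsub>G\<^esub> s) (act s x) = x"
      using x CY sG by (intro act_inv) auto
    then have "x \<in> act (inv\<^bsub>G\<^esub> s) ` C"
      using x(2) by (metis image_eqI)
    then show ?thesis
      using x sG by (auto simp: S0_def)
  qed
  \<comment> \<open>If \<open>y\<close> is the translate of \<open>x\<close> by the inverse of
    \<open>g\<close> and of \<open>x'\<close> by the inverse of \<open>k\<close>, then
    \<open>k\<close> times the inverse of \<open>g\<close> moves \<open>x\<close> to
    \<open>x'\<close>. That element is also the left factor that takes the index \<open>g\<close> to
    \<open>k\<close>.\<close>
  have adj: "k \<otimes>\<^bsub>G\<^esub> inv\<^bsub>G\<^esub> g \<in> S0"
    if g: "g \<in> carrier G" and k: "k \<in> carrier G" and gk: "g \<noteq> k" and y: "y \<in> T g" "y \<in> T k" for g k y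
  proof -
    obtain x x' where x: "x \<in> C" "y = act (inv\<^bsub>G\<^esub> g) x" "x' \<in> C" "y = act (inv\<^bsub>G\<^esub> k) x'"
      using y by (auto simp: T_def)
    have "act (k \<otimes>\<^bsub>G\<^esub> inv\<^bsub>G\<^esub> g) x = act k y"
      using x CY g k by (subst act_mult) auto
    also have "\<dots> = x'"
      unfolding x(4) using x(3) CY k by (intro act_inv(1)) auto
    finally have "x' \<in> act (k \<otimes>\<^bsub>G\<^esub> inv\<^bsub>G\<^esub> g) ` C \<inter> C"
      using x by auto
    moreover have "k \<otimes>\<^bsub>G\<^esub> inv\<^bsub>G\<^esub> g \<noteq> \<one>\<^bsub>G\<^esub>"
      using g k gk by (metis inv_equality inv_inv inv_closed)
    ultimately show ?thesis
      using g k by (auto simp: S0_def)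
  qed
  \<comment> \<open>\<open>t\<close> repairs the loss: indices in \<open>W\<close> have character at
    least - c, and right multiplication by \<open>t\<close> raises this to at least 0.\<close>
  obtain t where t: "t \<in> carrier G" "\<theta> t \<ge> c"
    using additive_character_unbounded[OF G \<theta>, of c] by auto
  \<comment> \<open>Left multiplication by \<open>u\<close> takes every vertex of \<open>P\<close>
    in a single step to the level that \<open>far\<close> requires. The maximum with 0 keeps that
    step inside \<open>P\<close>.\<close>
  obtain u where u: "u \<in> carrier G" "\<theta> u \<ge> max 0 (\<theta> t - h p0)"
    using additive_character_unbounded[OF G \<theta>, of "max 0 (\<theta> t - h p0)"] by auto
  define S where "S = S0 \<union> {u, inv\<^bsub>G\<^esub> u}"
  define E where "E = cayley_edges G S"
  define P where "P = {g \<in> carrier G. \<theta> g \<ge> 0}"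
  define W where "W = {g \<in> carrier G. \<theta> g \<ge> - c}"
  have S_carrier: "S \<subseteq> carrier G"
    using S0_carrier u by (auto simp: S_def)
  \<comment> \<open>The translate of \<open>p0\<close> by the inverse of \<open>g\<close> lies in
    the tile and has height h p0 + \<theta> g.\<close>
  have meets: "T g \<inter> N \<noteq> {}" if g: "g \<in> carrier G" "\<theta> g \<ge> - h p0" for g
  proof -
    have "p0 \<in> Y" using p0 \<Phi>Y by blast
    then have "act (inv\<^bsub>G\<^esub> g) p0 \<in> T g \<inter> N"
      using g p0 \<Phi>C by (auto simp: T_def N_def act_in h_act chi_inv)
    then show ?thesis by blast
  qed
  have chain: "(g, k) \<in> (E \<inter> W \<times> W)\<^sup>*"
    if g: "g \<in> carrier G" "\<theta> g \<ge> - h p0" and k: "k \<in> carrier G" "\<theta> k \<ge> - h p0" for g k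
  proof (rule ccontr)
    assume not: "(g, k) \<notin> (E \<inter> W \<times> W)\<^sup>*"
    \<comment> \<open>\<open>R\<close> collects the indices reachable from \<open>g\<close>. With
      \<open>k\<close> outside it, the tiles indexed by \<open>R\<close> and the remaining tiles cut
      \<open>N\<close> into two nonempty disjoint closed sets.\<close>
    define R where "R = {l \<in> carrier G. (g, l) \<in> (E \<inter> W \<times> W)\<^sup>*}"
    let ?A = "N \<inter> (\<Union>l\<in>R. T l)" and ?B = "N \<inter> (\<Union>l\<in>carrier G - R. T l)"
    have NY: "N \<subseteq> Y" by (auto simp: N_def)
    have "closedin (top_of_set N) ?A" "closedin (top_of_set N) ?B"
      by (intro closedin_Int_subspace[OF _ NY] Union_closed; simp add: R_def)+
    moreover have "N \<subseteq> ?A \<union> ?B"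
    proof
      fix y assume y: "y \<in> N"
      then obtain l where "l \<in> carrier G" "y \<in> T l"
        using T_cover[of y] NY by auto
      then show "y \<in> ?A \<union> ?B"
        using y by (cases "l \<in> R") auto
    qed
    moreover have "?A \<inter> ?B = {}"
    proof (rule ccontr)
      assume "?A \<inter> ?B \<noteq> {}"
      then obtain y l m where y: "y \<in> N" and l: "l \<in> R" "y \<in> T l" and m: "m \<in> carrier G" "m \<notin> R" "y \<in> T m"
        by auto
      have lG: "l \<in> carrier G" using l by (simp add: R_def)
      have "m \<otimes>\<^bsub>G\<^esub> inv\<^bsub>G\<^esub> l \<in> S"
        using adj[OF lG m(1) _ l(2) m(3)] l m by (auto simp: S_def)
      moreover have "m = (m \<otimes>\<^bsub>G\<^esub> inv\<^bsub>G\<^esub> l) \<otimes>\<^bsub>G\<^esub> l"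
        using lG m by (simp add: m_assoc)
      ultimately have "(l, m) \<in> E"
        using lG by (auto simp: E_def cayley_edges_def)
      \<comment> \<open>Both tiles contain \<open>y\<close>, where \<open>h\<close> is nonnegative,
        so \<open>T_h\<close> places both indices in \<open>W\<close>; this is what lets the edge
        prolong the walk.\<close>
      moreover have "l \<in> W" "m \<in> W"
        using T_h[OF lG l(2)] T_h[OF m(1,3)] y lG m by (auto simp: W_def N_def)
      ultimately have "(l, m) \<in> E \<inter> W \<times> W" by blast
      then have "m \<in> R"
        using l m by (auto simp: R_def intro: rtrancl_into_rtrancl)
      with m show False by blast
    qed
    moreover have "?A \<noteq> {}" "?B \<noteq> {}"
      using meets[OF g] meets[OF k] g k not by (auto simp: R_def)
    ultimately have "\<not> connected N"
      unfolding connected_closedin not_not by (intro exI[of _ ?A] exI[of _ ?B] conjI)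
    with con show False
      by (simp add: N_def)
  qed
  \<comment> \<open>Right multiplication commutes with the left multiplications that define edges,
    so it respects the graph; it raises the character by \<theta> t, which is at least
    \<open>c\<close>.\<close>
  have shift: "(a \<otimes>\<^bsub>G\<^esub> t, b \<otimes>\<^bsub>G\<^esub> t) \<in> (E \<inter> P \<times> P)\<^sup>*" if "(a, b) \<in> (E \<inter> W \<times> W)\<^sup>*" for a b
    using that
  proof (induction rule: rtrancl_induct)
    case (step b c')
    then obtain s where s: "s \<in> S" "c' = s \<otimes>\<^bsub>G\<^esub> b" "b \<in> W" "c' \<in> W"
      by (auto simp: E_def cayley_edges_def)
    then have "c' \<otimes>\<^bsub>G\<^esub> t = s \<otimes>\<^bsub>G\<^esub> (b \<otimes>\<^bsub>G\<^esub> t)"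
      using S_carrier t by (auto simp: W_def m_assoc)
    moreover have "b \<otimes>\<^bsub>G\<^esub> t \<in> P" "c' \<otimes>\<^bsub>G\<^esub> t \<in> P"
      using s(3,4) t by (auto simp: W_def P_def chi_mult)
    ultimately have "(b \<otimes>\<^bsub>G\<^esub> t, c' \<otimes>\<^bsub>G\<^esub> t) \<in> E \<inter> P \<times> P"
      using s(1) by (auto simp: E_def cayley_edges_def P_def)
    then show ?case
      using step.IH by (rule rtrancl_into_rtrancl[rotated])
  qed auto
  \<comment> \<open>The threshold is chosen so that dividing by \<open>t\<close> on the right leaves
    a character of at least - h p0, as \<open>chain\<close> requires.\<close>
  have far: "(g, k) \<in> (E \<inter> P \<times> P)\<^sup>*"
    if g: "g \<in> carrier G" "\<theta> g \<ge> \<theta> t - h p0" and k: "k \<in> carrier G" "\<theta> k \<ge> \<theta> t - h p0" for g k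
  proof -
    have "(g \<otimes>\<^bsub>G\<^esub> inv\<^bsub>G\<^esub> t, k \<otimes>\<^bsub>G\<^esub> inv\<^bsub>G\<^esub> t) \<in> (E \<inter> W \<times> W)\<^sup>*"
      using g k t by (intro chain) (auto simp: chi_mult chi_inv)
    from shift[OF this] show ?thesis
      using g k t by (simp add: m_assoc)
  qed
  \<comment> \<open>The walk climbs from \<open>g\<close> along the generator \<open>u\<close>,
    crosses by \<open>far\<close> to the product of \<open>u\<close> and \<open>k\<close>, and
    descends to \<open>k\<close> along the inverse of \<open>u\<close>.\<close>
  have conn: "(g, k) \<in> (E \<inter> P \<times> P)\<^sup>*" if g: "g \<in> P" and k: "k \<in> P" for g k
  proof -
    have gG: "g \<in> carrier G" "\<theta> g \<ge> 0" and kG: "k \<in> carrier G" "\<theta> k \<ge> 0"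
      using g k by (auto simp: P_def)
    have "(g, u \<otimes>\<^bsub>G\<^esub> g) \<in> E \<inter> P \<times> P"
      using gG u by (auto simp: E_def cayley_edges_def S_def P_def chi_mult)
    moreover have "(u \<otimes>\<^bsub>G\<^esub> g, u \<otimes>\<^bsub>G\<^esub> k) \<in> (E \<inter> P \<times> P)\<^sup>*"
      using gG kG u by (intro far) (auto simp: chi_mult)
    moreover have "(u \<otimes>\<^bsub>G\<^esub> k, k) \<in> E \<inter> P \<times> P"
    proof -
      have "k = inv\<^bsub>G\<^esub> u \<otimes>\<^bsub>G\<^esub> (u \<otimes>\<^bsub>G\<^esub> k)"
        using kG u by (simp add: m_assoc[symmetric])
      then show ?thesis
        using kG u by (auto simp: E_def cayley_edges_def S_def P_def chi_mult)
    qed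
    ultimately show ?thesis
      by (meson converse_rtrancl_into_rtrancl rtrancl_into_rtrancl)
  qed
  \<comment> \<open>A walk in \<open>P\<close> from the identity writes its end point as a word in
    \<open>S\<close>; elements of negative character are reached through their inverses.\<close>
  have P_gen: "g \<in> generate G S" if "g \<in> P" for g
  proof -
    have "\<one>\<^bsub>G\<^esub> \<in> P"
      using additive_character_one[OF G \<theta>(1)] by (simp add: P_def)
    from conn[OF this that] show ?thesis
    proof (induction rule: rtrancl_induct)
      case base
      then show ?case by (rule generate.one)
    next
      case (step b c')
      then show ?case
        by (auto simp: E_def cayley_edges_def intro: generate.eng generate.incl)
    qed
  qed
  have "carrier G \<subseteq> generate G S"
  proof
    fix g assume g: "g \<in> carrier G"
    show "g \<in> generate G S"
    proof (cases "\<theta> g \<ge> 0")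
      case True
      then show ?thesis using g P_gen by (simp add: P_def)
    next
      case False
      then have "inv\<^bsub>G\<^esub> g \<in> generate G S"
        using g by (intro P_gen) (auto simp: P_def chi_inv)
      then show ?thesis
        using g generate_m_inv_closed[OF S_carrier] by fastforce
    qed
  qed
  then have "generate G S = carrier G"
    using generate_incl[OF S_carrier] by blast
  moreover have "(\<lambda>s. inv\<^bsub>G\<^esub> s) ` S = S"
  proof -
    have sub: "(\<lambda>s. inv\<^bsub>G\<^esub> s) ` S \<subseteq> S"
      using S0_inv u by (auto simp: S_def)
    moreover have "S \<subseteq> (\<lambda>s. inv\<^bsub>G\<^esub> s) ` S"
    proof
      fix s assume s: "s \<in> S"
      have "inv\<^bsub>G\<^esub> s \<in> S" using sub s by blast
      then show "s \<in> (\<lambda>s. inv\<^bsub>G\<^esub> s) ` S"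
        using s S_carrier by (intro image_eqI[of _ _ "inv\<^bsub>G\<^esub> s"]) auto
    qed
    ultimately show ?thesis by blast
  qed
  moreover have "finite S"
    using S0_fin by (simp add: S_def)
  moreover have "spanned_connected (cayley_edges G S) {g \<in> carrier G. \<theta> g \<ge> 0}"
    using conn unfolding spanned_connected_def E_def P_def by blast
  ultimately show ?thesis
    unfolding BNS_set_def symmetric_generating_set_def using \<theta> S_carrier by blast
qed

section \<open>Periods\<close>

lemma differential_add_scaleR:
  assumes f: "smooth_fun A f" and g: "smooth_fun A g" and c: "c \<in> A" "p \<in> fst c"
  shows "differential (\<lambda>x. f x + k *\<^sub>R g x) c p v = differential f c p v + k *\<^sub>R differential g c p v"
proof -
  have d: "((f \<circ> chart_inv c) has_derivative differential f c p) (at (snd c p))"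
    "((g \<circ> chart_inv c) has_derivative differential g c p) (at (snd c p))"
    using smooth_on_differentiable[OF smooth_fun_chart[OF f c(1)]] smooth_on_differentiable[OF smooth_fun_chart[OF g c(1)]] c(2)
    by (simp_all add: frechet_derivative_works differential_def[abs_def])
  have "((\<lambda>z. (f \<circ> chart_inv c) z + k *\<^sub>R (g \<circ> chart_inv c) z) has_derivative
      (\<lambda>v. differential f c p v + k *\<^sub>R differential g c p v)) (at (snd c p))"
    by (intro has_derivative_add has_derivative_scaleR_right d)
  moreover have "(\<lambda>z. (f \<circ> chart_inv c) z + k *\<^sub>R (g \<circ> chart_inv c) z) = (\<lambda>x. f x + k *\<^sub>R g x) \<circ> chart_inv c"
    by auto
  ultimately have "((\<lambda>x. f x + k *\<^sub>R g x) \<circ> chart_inv c has_derivative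
      (\<lambda>v. differential f c p v + k *\<^sub>R differential g c p v)) (at (snd c p))"
    by simp
  from frechet_derivative_at[OF this] show ?thesis
    unfolding differential_def[of "\<lambda>x. f x + k *\<^sub>R g x"] by metis
qed

lemma smooth_fun_add_scaleR:
  assumes m: "smooth_manifold X A" and f: "smooth_fun A f" and g: "smooth_fun A g"
  shows "smooth_fun A (\<lambda>x. f x + k *\<^sub>R g x)"
proof -
  have "smooth_on (snd c ` fst c) ((\<lambda>x. f x + k *\<^sub>R g x) \<circ> chart_inv c)" if c: "c \<in> A" for c
    using smooth_on_add_scaleR[OF chart_image_open[OF m c] smooth_fun_chart[OF f c] smooth_fun_chart[OF g c], of k]
    by (simp add: o_def)
  then show ?thesis
    by (auto simp: smooth_fun_def case_prod_beta)
qed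

lemma smooth_fun_const: "smooth_fun A (\<lambda>_. k)"
  by (auto simp: smooth_fun_def o_def smooth_on_const)

lemma differential_const: "differential (\<lambda>_. k) c p v = 0"
  by (simp add: differential_def o_def)

lemma cohomologous_refl: "\<alpha> \<in> closed_forms A \<Longrightarrow> (\<alpha>, \<alpha>) \<in> cohomologous A"
  unfolding cohomologous_def
  by (auto simp: form_eq_def differential_const intro!: exI[of _ "\<lambda>_. 0"] smooth_fun_const)

text \<open>The primitive of the combined difference is \<open>f + k g\<close>. Taking k = -1 and k
  = 1 yields the two inclusions between the classes of cohomologous forms.\<close>

lemma cohomologous_linear:
  assumes m: "smooth_manifold X A" and 1: "(\<alpha>, \<beta>) \<in> cohomologous A" and 2: "(\<alpha>', \<gamma>) \<in> cohomologous A"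
    and k: "\<And>c p v. c \<in> A \<Longrightarrow> p \<in> fst c \<Longrightarrow> \<epsilon> c p v - \<delta> c p v = (\<beta> c p v - \<alpha> c p v) + k * (\<gamma> c p v - \<alpha>' c p v)"
    and cl: "\<delta> \<in> closed_forms A" "\<epsilon> \<in> closed_forms A"
  shows "(\<delta>, \<epsilon>) \<in> cohomologous A"
proof -
  obtain f where f: "smooth_fun A f" "form_eq A (\<lambda>c p v. \<beta> c p v - \<alpha> c p v) (differential f)"
    using 1 by (auto simp: cohomologous_def)
  obtain g where g: "smooth_fun A g" "form_eq A (\<lambda>c p v. \<gamma> c p v - \<alpha>' c p v) (differential g)"
    using 2 by (auto simp: cohomologous_def)
  let ?F = "\<lambda>x. f x + k *\<^sub>R g x"
  have "form_eq A (\<lambda>c p v. \<epsilon> c p v - \<delta> c p v) (differential ?F)"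
    unfolding form_eq_def
  proof (intro ballI allI)
    fix c p v assume c: "c \<in> A" "p \<in> fst c"
    have "\<beta> c p v - \<alpha> c p v = differential f c p v" "\<gamma> c p v - \<alpha>' c p v = differential g c p v"
      using f(2) g(2) c unfolding form_eq_def by blast+
    then show "\<epsilon> c p v - \<delta> c p v = differential ?F c p v"
      using k[OF c] differential_add_scaleR[OF f(1) g(1) c] by simp
  qed
  then show ?thesis
    using smooth_fun_add_scaleR[OF m f(1) g(1)] cl unfolding cohomologous_def by blast
qed

lemma de_Rham_class_eqI:
  assumes m: "smooth_manifold X A" and ab: "(\<alpha>, \<beta>) \<in> cohomologous A"
  shows "de_Rham_class A \<alpha> = de_Rham_class A \<beta>"
proof -
  have cl: "\<alpha> \<in> closed_forms A" "\<beta> \<in> closed_forms A"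
    using ab by (auto simp: cohomologous_def)
  have "(\<beta>, \<gamma>) \<in> cohomologous A" if "(\<alpha>, \<gamma>) \<in> cohomologous A" for \<gamma>
    using that by (intro cohomologous_linear[OF m that ab, where k = "-1"] cl) (auto simp: cohomologous_def)
  moreover have "(\<alpha>, \<gamma>) \<in> cohomologous A" if "(\<beta>, \<gamma>) \<in> cohomologous A" for \<gamma>
    using that by (intro cohomologous_linear[OF m that ab, where k = 1] cl) (auto simp: cohomologous_def)
  ultimately show ?thesis
    unfolding de_Rham_class_def by blast
qed

lemma zero_closed_form: "(\<lambda>_ _ _. 0) \<in> closed_forms A"
  by (simp add: closed_forms_def one_form_def smooth_on_const linear_iff)

context smooth_cover
begin

text \<open>All admissible forms and loops give one value: every lift of a loop in \<gamma> from
  \<open>y0\<close> ends where \<open>l\<close> ends, and an exact correction integrates to 0 over a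
  loop. To settle the definite description one witness is still required, namely \<alpha> with a
  piecewise C1 loop in the class.\<close>

lemma period_character_lift:
  assumes y0: "y0 \<in> Y" and \<alpha>: "\<alpha> \<in> closed_forms A" and h: "is_primitive A B \<pi> \<alpha> h"
    and \<gamma>: "\<gamma> \<in> carrier (fundamental_group X (\<pi> y0))" and l: "based_cover.lift_of Y \<pi> y0 \<gamma> l"
  shows "period_character X A (\<pi> y0) (de_Rham_class A \<alpha>) \<gamma> = h (pathfinish l) - h y0"
proof -
  interpret based_cover X Y \<pi> y0
    by unfold_locales (fact covering Y_simply_connected Y_locally_path_connected y0)+
  let ?r = "h (pathfinish l) - h y0"
  have \<alpha>1: "one_form A \<alpha>"
    using \<alpha> by (simp add: closed_forms_def)
  have all: "line_integral A \<beta> g = ?r"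
    if \<beta>: "\<beta> \<in> de_Rham_class A \<alpha>" and g: "g \<in> \<gamma>" "piecewise_C1_path X A g" for \<beta> g
  proof -
    obtain f where f: "smooth_fun A f" "form_eq A (\<lambda>c p v. \<beta> c p v - \<alpha> c p v) (differential f)"
      using \<beta> by (auto simp: de_Rham_class_def cohomologous_def)
    obtain m where m: "lift_of \<gamma> m" "\<And>t. t \<in> {0..1} \<Longrightarrow> \<pi> (m t) = g t"
      using lift_exists[OF \<gamma> g(1)] by metis
    have m': "path m" "path_image m \<subseteq> Y" "pathstart m = y0"
      using m(1) by (auto simp: lift_of_def)
    have "line_integral A \<beta> g = h (pathfinish m) - h (pathstart m) + (f (pathfinish g) - f (pathstart g))"
      by (rule line_integral_lift[OF \<alpha>1 h f g(2) m'(1,2) m(2)])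
    also have "\<dots> = ?r"
      using lift_finish_unique[OF \<gamma> m(1) l] m'(3) homotopic_in_class(2)[OF \<gamma> g(1)] by (simp add: loops_at_def)
    finally show ?thesis .
  qed
  \<comment> \<open>The piecewise C1 member of \<gamma> is obtained upstairs, as the projection of a
    path to the same end point.\<close>
  obtain m where m: "C1_lift m y0 (pathfinish l)"
    using C1_lift_exists[OF y0 lift_finish(1)[OF \<gamma> l]] by metis
  have "lift_of \<gamma> m"
    using m by (intro lift_of_homotopic[OF \<gamma> l]) (auto simp: C1_lift_def)
  then have wit: "\<pi> \<circ> m \<in> \<gamma>" "piecewise_C1_path X A (\<pi> \<circ> m)"
    using m by (auto simp: lift_of_def C1_lift_def)
  have self: "\<alpha> \<in> de_Rham_class A \<alpha>"
    using cohomologous_refl[OF \<alpha>] by (simp add: de_Rham_class_def)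
  have "(THE r. \<forall>\<beta>\<in>de_Rham_class A \<alpha>. \<forall>g\<in>\<gamma>. piecewise_C1_path X A g \<longrightarrow> line_integral A \<beta> g = r) = ?r"
  proof (rule the_equality)
    show "\<forall>\<beta>\<in>de_Rham_class A \<alpha>. \<forall>g\<in>\<gamma>. piecewise_C1_path X A g \<longrightarrow> line_integral A \<beta> g = ?r"
      using all by blast
    fix r assume "\<forall>\<beta>\<in>de_Rham_class A \<alpha>. \<forall>g\<in>\<gamma>. piecewise_C1_path X A g \<longrightarrow> line_integral A \<beta> g = r"
    from this[rule_format, OF self wit] show "r = ?r"
      using all[OF self wit] by simp
  qed
  then show ?thesis
    using \<gamma> by (simp add: period_character_def)
qed

text \<open>A path \<open>m\<close> from the end of \<open>l\<close> to \<open>y\<close> and its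
  image under \<open>act \<gamma>\<close> have the same projection, hence the same line integral.
  One lift gives h y - h (pathfinish l), the other h (act \<gamma> y) - h y0; the minus sign
  reflects the inverse in \<open>deck_action\<close>.\<close>

lemma primitive_deck_action:
  assumes y0: "y0 \<in> Y" and \<alpha>: "\<alpha> \<in> closed_forms A" and h: "is_primitive A B \<pi> \<alpha> h"
    and \<gamma>: "\<gamma> \<in> carrier (fundamental_group X (\<pi> y0))" and y: "y \<in> Y"
  shows "h (deck_action Y \<pi> y0 \<gamma> y) = h y - period_character X A (\<pi> y0) (de_Rham_class A \<alpha>) \<gamma>"
proof -
  interpret based_cover X Y \<pi> y0
    by unfold_locales (fact covering Y_simply_connected Y_locally_path_connected y0)+
  have \<alpha>1: "one_form A \<alpha>"
    using \<alpha> by (simp add: closed_forms_def)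
  \<comment> \<open>The form to be integrated is \<alpha> itself, so the exact correction is
    zero.\<close>
  have f: "smooth_fun A (\<lambda>_. 0)" "form_eq A (\<lambda>c p v. \<alpha> c p v - \<alpha> c p v) (differential (\<lambda>_. 0))"
    by (simp_all add: smooth_fun_const form_eq_def differential_const)
  obtain l where l: "lift_of \<gamma> l"
    using lift_exists class_nonempty[OF \<gamma>] \<gamma> by metis
  obtain m where m: "C1_lift m (pathfinish l) y"
    using C1_lift_exists[OF lift_finish(1)[OF \<gamma> l] y] by metis
  have m': "path m" "path_image m \<subseteq> Y" "pathstart m = pathfinish l" "pathfinish m = y"
    "piecewise_C1_path X A (\<pi> \<circ> m)"
    using m by (auto simp: C1_lift_def)
  note act = deckD[OF act_deck[OF \<gamma>]]
  have mY: "m t \<in> Y" if "t \<in> {0..1}" for t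
    using m'(2) that by (auto simp: path_image_def)
  have am: "path (act \<gamma> \<circ> m)" "path_image (act \<gamma> \<circ> m) \<subseteq> Y"
    using m'(1,2) mY act(3) by (auto intro!: path_continuous_image continuous_on_subset[OF act(1)] simp: path_image_def)
  have "line_integral A \<alpha> (\<pi> \<circ> m) = h y - h (pathfinish l)"
    using line_integral_lift[OF \<alpha>1 h f m'(5) m'(1,2)] m'(3,4) by simp
  moreover have "line_integral A \<alpha> (\<pi> \<circ> m) = h (act \<gamma> y) - h y0"
    using line_integral_lift[OF \<alpha>1 h f m'(5) am] act(4)[OF mY] m'(3,4) act_lift_finish[OF \<gamma> l]
    by (simp add: pathstart_compose pathfinish_compose)
  ultimately show ?thesis
    using period_character_lift[OF y0 \<alpha> h \<gamma> l] by simp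
qed

text \<open>With all periods zero, transitivity of the action on fibres makes \<open>h\<close> a
  function \<open>f\<close> on \<open>X\<close>. The substance is that \<open>f\<close> is smooth
  with differential \<alpha>, contrary to the class being nonzero.\<close>

lemma period_character_nonzero:
  assumes y0: "y0 \<in> Y" and \<alpha>: "\<alpha> \<in> closed_forms A" and h: "is_primitive A B \<pi> \<alpha> h"
    and ne: "de_Rham_class A \<alpha> \<noteq> de_Rham_class A (\<lambda>_ _ _. 0)"
  shows "\<exists>\<gamma>\<in>carrier (fundamental_group X (\<pi> y0)). period_character X A (\<pi> y0) (de_Rham_class A \<alpha>) \<gamma> \<noteq> 0"
proof (rule ccontr)
  interpret based_cover X Y \<pi> y0
    by unfold_locales (fact covering Y_simply_connected Y_locally_path_connected y0)+
  assume "\<not> ?thesis"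
  then have per: "period_character X A (\<pi> y0) (de_Rham_class A \<alpha>) \<gamma> = 0" if "\<gamma> \<in> carrier \<Gamma>" for \<gamma>
    using that by auto
  have \<alpha>1: "one_form A \<alpha>"
    using \<alpha> by (simp add: closed_forms_def)
  have fib: "h y = h y'" if yy: "y \<in> Y" "y' \<in> Y" "\<pi> y = \<pi> y'" for y y'
  proof -
    obtain \<gamma> where \<gamma>: "\<gamma> \<in> carrier \<Gamma>" "act \<gamma> y = y'"
      using act_transitive[OF yy] by metis
    then show ?thesis
      using primitive_deck_action[OF y0 \<alpha> h \<gamma>(1) yy(1)] per[OF \<gamma>(1)] by simp
  qed
  define f where "f x = h (SOME y. y \<in> Y \<and> \<pi> y = x)" for x
  have f\<pi>: "f (\<pi> y) = h y" if "y \<in> Y" for y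
  proof -
    have "\<exists>z. z \<in> Y \<and> \<pi> z = \<pi> y" using that by auto
    from someI_ex[OF this] show ?thesis
      unfolding f_def using fib that by blast
  qed
  \<comment> \<open>Locally \<open>f\<close> is \<open>h\<close> composed with a section, so its
    derivative in a chart is the local expression of \<alpha>.\<close>
  have der: "((f \<circ> chart_inv c) has_derivative \<alpha> c p) (at (snd c p))" if c: "c \<in> A" "p \<in> fst c" for c p
  proof -
    have "p \<in> \<pi> ` Y"
      using subsetD[OF openin_imp_subset[OF chart_domain_openin[OF X_manifold c(1)]] c(2)] proj(2) by simp
    then obtain y where y: "y \<in> Y" "p = \<pi> y" by auto
    obtain D W \<sigma> where D: "y \<in> D" "openin (top_of_set Y) D" and W: "openin (top_of_set X) W"
      and hom: "homeomorphism D W \<pi> \<sigma>"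
      and d: "((h \<circ> \<sigma> \<circ> chart_inv c) has_derivative \<alpha> c (\<pi> y)) (at (snd c (\<pi> y)))"
      using primitive_section_derivative[OF \<alpha>1 h y(1) c(1)] c(2) y(2) by metis
    have Q: "open (snd c ` (fst c \<inter> W))"
      using chart_domain_openin[OF X_manifold c(1)] W by (intro chart_image_openin[OF X_manifold c(1)]) auto
    have "\<pi> y \<in> W"
      using hom D(1) by (auto simp: homeomorphism_def)
    then have yQ: "snd c (\<pi> y) \<in> snd c ` (fst c \<inter> W)"
      using c(2) y(2) by blast
    show ?thesis
      unfolding y(2)
    proof (rule has_derivative_transform_within_open[OF d Q yQ])
      fix z assume "z \<in> snd c ` (fst c \<inter> W)"
      then obtain x where x: "x \<in> fst c" "x \<in> W" "z = snd c x" by auto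
      have "\<sigma> x \<in> D" "\<pi> (\<sigma> x) = x"
        using hom x(2) by (auto simp: homeomorphism_def)
      then have "h (\<sigma> x) = f x"
        using f\<pi>[OF subsetD[OF openin_imp_subset[OF D(2)]]] by metis
      then show "(h \<circ> \<sigma> \<circ> chart_inv c) z = (f \<circ> chart_inv c) z"
        using x chart_inv_apply[OF X_manifold c(1) x(1)] by simp
    qed
  qed
  \<comment> \<open>A case distinction on the order is enough: the first derivatives of
    \<open>f\<close> in a chart are the coefficients of \<alpha>, smooth since \<alpha> is a
    one-form, so order j + 1 for \<open>f\<close> is order j for them.\<close>
  have sf: "smooth_on (snd c ` fst c) (f \<circ> chart_inv c)" if c: "c \<in> A" for c
    unfolding smooth_on_def
  proof
    fix k
    have der': "((f \<circ> chart_inv c) has_derivative \<alpha> c (chart_inv c z)) (at z)" if z: "z \<in> snd c ` fst c" for z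
    proof -
      obtain x where x: "x \<in> fst c" "z = snd c x" using z by auto
      show ?thesis
        using der[OF c x(1)] x chart_inv_apply[OF X_manifold c x(1)] by simp
    qed
    have diff: "(f \<circ> chart_inv c) differentiable (at z)" if "z \<in> snd c ` fst c" for z
      using der'[OF that] unfolding differentiable_def by blast
    show "higher_differentiable_on (snd c ` fst c) (f \<circ> chart_inv c) k"
    proof (cases k)
      case 0
      have "continuous_on (snd c ` fst c) (f \<circ> chart_inv c)"
        using diff by (intro continuous_at_imp_continuous_on ballI differentiable_imp_continuous_within)
      then show ?thesis by (simp add: 0)
    next
      case (Suc j)
      have "higher_differentiable_on (snd c ` fst c) (\<lambda>z. frechet_derivative (f \<circ> chart_inv c) (at z) v) j" for v
      proof (rule higher_differentiable_on_cong[OF chart_image_open[OF X_manifold c]])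
        have "\<forall>c\<in>A. \<forall>v. smooth_on (snd c ` fst c) (\<lambda>y. \<alpha> c (chart_inv c y) v)"
          using \<alpha>1 unfolding one_form_def by (elim conjE)
        from this[rule_format, OF c, of v]
        show "higher_differentiable_on (snd c ` fst c) (\<lambda>y. \<alpha> c (chart_inv c y) v) j"
          by (simp add: smooth_on_def)
        show "\<alpha> c (chart_inv c z) v = frechet_derivative (f \<circ> chart_inv c) (at z) v" if "z \<in> snd c ` fst c" for z
          using frechet_derivative_at[OF der'[OF that]] by simp
      qed
      then show ?thesis
        using diff by (simp add: Suc)
    qed
  qed
  have "smooth_fun A f"
    using sf by (auto simp: smooth_fun_def)
  moreover have "form_eq A (\<lambda>c p v. \<alpha> c p v - 0) (differential f)"
    unfolding form_eq_def differential_def using frechet_derivative_at[OF der] by simp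
  ultimately have "(\<lambda>_ _ _. 0, \<alpha>) \<in> cohomologous A"
    using \<alpha> zero_closed_form unfolding cohomologous_def by blast
  from de_Rham_class_eqI[OF X_manifold this] ne show False
    by simp
qed

end

theorem lemma2p9:
  fixes X :: "'a::topological_space set"
    and A :: "('a, 'e::euclidean_space) chart set"
    and Xt :: "'b::topological_space set"
    and At :: "('b, 'e) chart set"
    and \<pi> :: "'b \<Rightarrow> 'a"
    and xt0 :: 'b
    and \<xi> :: "('a, 'e) form set"
    and \<Phi> :: "'b set"
    and \<alpha> :: "('a, 'e) form"
    and h :: "'b \<Rightarrow> real"
  assumes "smooth_manifold X A"
    and "smooth_universal_cover X A Xt At \<pi>"
    and "xt0 \<in> Xt"
    and "\<xi> \<in> de_Rham_H1 A"
    and "\<xi> \<noteq> de_Rham_class A (\<lambda>_ _ _. 0)"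
    and "taming_pair X A Xt At \<pi> xt0 \<xi> \<Phi> \<alpha>"
    and "is_primitive A At \<pi> \<alpha> h"
    and "connected {x \<in> Xt. h x \<ge> 0}"
  shows "character_ray (fundamental_group X (\<pi> xt0)) (period_character X A (\<pi> xt0) \<xi>)
           \<in> BNS_set (fundamental_group X (\<pi> xt0))"
proof -
  interpret smooth_cover X A Xt At \<pi>
    by unfold_locales fact+
  interpret based_cover X Xt \<pi> xt0
    by unfold_locales (fact covering Y_simply_connected Y_locally_path_connected assms(3))+
  have fd: "fundamental_domain \<Gamma> act Xt \<Phi>" and \<alpha>: "\<alpha> \<in> closed_forms A"
    and gf: "geometrically_finite \<Gamma> act Xt \<Phi>" and \<xi>: "de_Rham_class A \<alpha> = \<xi>"
    and bdd: "bdd_above (h ` \<Phi>)"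
    using assms(6,7) by (simp_all add: taming_pair_def)
  let ?\<theta> = "period_character X A (\<pi> xt0) \<xi>"
  have h_act: "h (act \<gamma> y) = h y - ?\<theta> \<gamma>" if "\<gamma> \<in> carrier \<Gamma>" "y \<in> Xt" for \<gamma> y
    using primitive_deck_action[OF base \<alpha> assms(7) that] by (simp add: \<xi>)
  have grp: "group \<Gamma>"
    by (rule group_fundamental_group[OF base_in_X])
  \<comment> \<open>Additivity is read off from \<open>h\<close> at the orbit of \<open>xt0\<close>:
    \<open>h_act\<close> is applied once to the product and once in two stages through
    \<open>act \<delta> xt0\<close>.\<close>
  have "?\<theta> (\<gamma> \<otimes>\<^bsub>\<Gamma>\<^esub> \<delta>) = ?\<theta> \<gamma> + ?\<theta> \<delta>" if "\<gamma> \<in> carrier \<Gamma>" "\<delta> \<in> carrier \<Gamma>" for \<gamma> \<delta>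
  proof -
    have "\<gamma> \<otimes>\<^bsub>\<Gamma>\<^esub> \<delta> \<in> carrier \<Gamma>"
      using that group.is_monoid[OF grp] by (simp add: monoid.m_closed)
    moreover have "act \<delta> xt0 \<in> Xt"
      by (rule deckD(3)[OF act_deck[OF that(2)] base])
    ultimately show ?thesis
      using h_act[of "\<gamma> \<otimes>\<^bsub>\<Gamma>\<^esub> \<delta>" xt0] h_act[of \<gamma> "act \<delta> xt0"] h_act[of \<delta> xt0] that base
        act_mult[OF that base] by simp
  qed
  then have "?\<theta> \<in> additive_characters \<Gamma>"
    by (simp add: additive_characters_def period_character_def)
  moreover have "\<exists>\<gamma>\<in>carrier \<Gamma>. ?\<theta> \<gamma> \<noteq> 0"
    using period_character_nonzero[OF base \<alpha> assms(7)] assms(5) by (simp add: \<xi>)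
  moreover have "continuous_on Xt h"
    using assms(7) by (intro smooth_fun_continuous[OF Y_manifold]) (simp add: is_primitive_def)
  ultimately show ?thesis
    using base
    by (intro BNS_setI[OF grp _ _ _ _ act_mult act_one _ h_act fd gf bdd assms(8)] deckD(1,3)[OF act_deck]) auto
qed

end
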